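(* Suppose $Z$ is a hidden Markov model satisfying the following conditions. (i) For each state $j\in\mathcal Y$, $$\mu\Big(\Big\{x\in\mathcal X:\ f_j(x)p_{\cdot j}>\max_{i\in\mathcal Y,\ i\ne j}f_i(x)p_{\cdot i}\Big\}\Big)>0,\qquad\text{where } p_{\cdot j}:=\max_{i\in\mathcal Y}p_{ij}.$$ (ii) There exists a weak cluster $C\subset\mathcal Y$, $C\neq\emptyset$, such that the sub-stochastic matrix $\mathbb P_C=(p_{ij})_{i,j\in C}$ is primitive in the sense that $\mathbb P_C^R$ consists of only positive elements for some positive integer $R$. Also let the Markov chain $Y$ be irreducible. Then there exist $i\in\mathcal Y$, $M\geq 1$ and a set $\mathcal X^*\subset\mathcal X^M$ consisting of strong $i$-barriers of a fixed order and satisfying $P(X\in\mathcal X^*\text{ i.o.})=1$.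
   Context: $\mathcal X$ is a separable metric space with Borel $\sigma$-field $\mathcal B(\mathcal X)$; $\mathcal Y=\{1,\dots,|\mathcal Y|\}$ is finite; $\mathcal Z=\mathcal X\times\mathcal Y$. $\mu$ is a $\sigma$-finite measure on $\mathcal B(\mathcal X)$ and $c$ is counting measure on $\mathcal Y$. A hidden Markov model (HMM) is a homogeneous Markov chain $Z=\{(X_k,Y_k)\}_{k\ge1}$ on $\mathcal Z$ whose transition kernel has density with respect to $\mu\times c$ of the form $q(x,j|x',i)=p_{ij}f_j(x)$, where $(p_{ij})_{i,j\in\mathcal Y}$ is a stochastic matrix (the transition matrix of the Markov chain $Y=\{Y_k\}$) and each emission density $f_j$ is a probability density with respect to $\mu$. The initial distribution of $Z$ is arbitrary with a density $p(x_1,y_1)$ with respect to the product of some $\sigma$-finite measure on $\mathcal B(\mathcal X)$ and $c$ (no stationarity is assumed). $X=\{X_k\}$. Write $x_{k:l}=(x_k,\dots,x_l)$. Let $G_i=\{x\in\mathcal X: f_i(x)>0\}$. A subset $C\subset\mathcal Y$ is a weak cluster if $\mu\big[\big(\bigcap_{i\in C}G_i\big)\setminus\big(\bigcup_{i\notin C}G_i\big)\big]>0$. For $n\ge2$, $p_{ij}(x_{1:n})=\max_{y_{1:n}:\,y_1=i,\,y_n=j}\prod_{k=2}^n q(x_k,y_k|x_{k-1},y_{k-1})$. For a given observation sequence put $\delta_1(y)=p(x_1,y)$ and, for $t\ge2$, $\delta_t(y)=\max_{y_{1:t}:\,y_t=y}p(x_1,y_1)\prod_{k=2}^t q(x_k,y_k|x_{k-1},y_{k-1})$.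 Given $x_{1:m}$ and $t<m$, the time $t$ is an $i$-node of order $r=m-t$ if $\delta_t(i)p_{ij}(x_{t:m})\ge\delta_t(k)p_{kj}(x_{t:m})$ for all $j,k\in\mathcal Y$; it is a strong $i$-node of order $r$ if moreover this inequality is strict for every $j$ and every $k\ne i$ for which its left side is positive. A vector $b_{1:M}\in\mathcal X^M$ is a strong $i$-barrier of order $r$ (and length $M$) if for any $x_{1:\infty}$ with $x_{m-M+1:m}=b_{1:M}$ for some $m\ge M$, the time $m-r$ is a strong $i$-node of order $r$ (with respect to $x_{1:m}$). For $\mathcal X^*\subset\mathcal X^M$: $\{X\in\mathcal X^*\text{ i.o.}\}=\bigcap_{k\ge1}\bigcup_{l\ge k}\{X_{l:l+M-1}\in\mathcal X^*\}$. *)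

theory Defs
  imports "HOL-Probability.Probability"
begin

section \<open>Stochastic matrices over a finite state space\<close>

definition stochastic_matrix :: "('y::finite \<Rightarrow> 'y \<Rightarrow> real) \<Rightarrow> bool" where
  "stochastic_matrix p \<longleftrightarrow> (\<forall>i j. 0 \<le> p i j) \<and> (\<forall>i. (\<Sum>j\<in>UNIV. p i j) = 1)"

text \<open>Powers of the submatrix with rows and columns in \<open>C\<close>; only entries with both
  indices in \<open>C\<close> are meaningful.\<close>

fun submatrix_power :: "'y set \<Rightarrow> ('y \<Rightarrow> 'y \<Rightarrow> real) \<Rightarrow> nat \<Rightarrow> 'y \<Rightarrow> 'y \<Rightarrow> real" where
  "submatrix_power C p 0 i j = (if i = j then 1 else 0)"
| "submatrix_power C p (Suc n) i j = (\<Sum>k\<in>C. submatrix_power C p n i k * p k j)"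

definition primitive_on :: "'y set \<Rightarrow> ('y \<Rightarrow> 'y \<Rightarrow> real) \<Rightarrow> bool" where
  "primitive_on C p \<longleftrightarrow> (\<exists>R\<ge>1. \<forall>i\<in>C. \<forall>j\<in>C. 0 < submatrix_power C p R i j)"

definition irreducible_matrix :: "('y::finite \<Rightarrow> 'y \<Rightarrow> real) \<Rightarrow> bool" where
  "irreducible_matrix p \<longleftrightarrow> (\<forall>i j. \<exists>n\<ge>1. 0 < submatrix_power UNIV p n i j)"

definition col_max :: "('y::finite \<Rightarrow> 'y \<Rightarrow> real) \<Rightarrow> 'y \<Rightarrow> real" where
  "col_max p j = Max (range (\<lambda>i. p i j))"

section \<open>Markov chains and hidden Markov models\<close>

text \<open>All sequences (processes, observation sequences, state paths) are indexed by \<open>1, 2, \<dots>\<close>;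
  the value at index \<open>0\<close> is irrelevant throughout.\<close>

text \<open>The \<open>\<sigma>\<close>-algebra generated by \<open>Z\<^sub>1, \<dots>, Z\<^sub>k\<close>.\<close>

definition past_algebra ::
    "'w measure \<Rightarrow> 'z measure \<Rightarrow> (nat \<Rightarrow> 'w \<Rightarrow> 'z) \<Rightarrow> nat \<Rightarrow> 'w measure" where
  "past_algebra P N Z k =
     vimage_algebra (space P) (\<lambda>\<omega>. \<lambda>l\<in>{1..k}. Z l \<omega>) (\<Pi>\<^sub>M l\<in>{1..k}. N)"

definition homogeneous_markov_chain ::
    "'w measure \<Rightarrow> 'z measure \<Rightarrow> ('z \<Rightarrow> 'z measure) \<Rightarrow> (nat \<Rightarrow> 'w \<Rightarrow> 'z) \<Rightarrow> bool" where
  "homogeneous_markov_chain P N \<kappa> Z \<longleftrightarrow>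
     \<kappa> \<in> N \<rightarrow>\<^sub>M prob_algebra N \<and>
     (\<forall>k\<ge>1. Z k \<in> P \<rightarrow>\<^sub>M N) \<and>
     (\<forall>k\<ge>1. \<forall>A\<in>sets N. AE \<omega> in P.
        real_cond_exp P (past_algebra P N Z k) (\<lambda>\<omega>'. indicator A (Z (Suc k) \<omega>')) \<omega>
          = measure (\<kappa> (Z k \<omega>)) A)"

text \<open>\<open>hmm_q p f (x', i) (x, j)\<close> is the transition density written \<open>q(x, j | x', i)\<close>.\<close>

definition hmm_q :: "('y \<Rightarrow> 'y \<Rightarrow> real) \<Rightarrow> ('y \<Rightarrow> 'x \<Rightarrow> real) \<Rightarrow> 'x \<times> 'y \<Rightarrow> 'x \<times> 'y \<Rightarrow> real" where
  "hmm_q p f = (\<lambda>(x', i) (x, j). p i j * f j x)"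

text \<open>The reference measure \<open>\<nu>\<close> of the initial density \<open>p\<^sub>1\<close> need not be the reference
  measure \<open>\<mu>\<close> of the emission densities.\<close>

definition hidden_markov_model ::
    "'w measure \<Rightarrow> (nat \<Rightarrow> 'w \<Rightarrow> 'x::{metric_space, second_countable_topology}) \<Rightarrow>
     (nat \<Rightarrow> 'w \<Rightarrow> 'y::finite) \<Rightarrow> 'x measure \<Rightarrow> ('y \<Rightarrow> 'y \<Rightarrow> real) \<Rightarrow> ('y \<Rightarrow> 'x \<Rightarrow> real) \<Rightarrow>
     'x measure \<Rightarrow> ('x \<times> 'y \<Rightarrow> real) \<Rightarrow> bool" where
  "hidden_markov_model P X Y \<mu> p f \<nu> p\<^sub>1 \<longleftrightarrow>
     prob_space P \<and>
     sigma_finite_measure \<mu> \<and> sets \<mu> = sets borel \<and>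
     stochastic_matrix p \<and>
     (\<forall>j. f j \<in> borel_measurable borel \<and> (\<forall>x. 0 \<le> f j x) \<and> (\<integral>\<^sup>+x. ennreal (f j x) \<partial>\<mu>) = 1) \<and>
     homogeneous_markov_chain P (borel \<Otimes>\<^sub>M count_space UNIV)
       (\<lambda>z'. density (\<mu> \<Otimes>\<^sub>M count_space UNIV) (\<lambda>z. ennreal (hmm_q p f z' z)))
       (\<lambda>k \<omega>. (X k \<omega>, Y k \<omega>)) \<and>
     sigma_finite_measure \<nu> \<and> sets \<nu> = sets borel \<and>
     (\<forall>z. 0 \<le> p\<^sub>1 z) \<and>
     distributed P (\<nu> \<Otimes>\<^sub>M count_space UNIV) (\<lambda>\<omega>. (X 1 \<omega>, Y 1 \<omega>)) (\<lambda>z. ennreal (p\<^sub>1 z))"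

definition weak_cluster :: "'x measure \<Rightarrow> ('y \<Rightarrow> 'x \<Rightarrow> real) \<Rightarrow> 'y set \<Rightarrow> bool" where
  "weak_cluster \<mu> f C \<longleftrightarrow>
     0 < emeasure \<mu> ((\<Inter>i\<in>C. {x. 0 < f i x}) - (\<Union>i\<in>-C. {x. 0 < f i x}))"

section \<open>Nodes and barriers\<close>

text \<open>\<open>path_max q x t m i j\<close> is \<open>p\<^sub>i\<^sub>j(x\<^sub>t\<^sub>:\<^sub>m)\<close> for \<open>t < m\<close>; the state paths are indexed by
  the actual times \<open>t, \<dots>, m\<close>.\<close>

definition path_max ::
    "('x \<times> 'y \<Rightarrow> 'x \<times> 'y \<Rightarrow> real) \<Rightarrow> (nat \<Rightarrow> 'x) \<Rightarrow> nat \<Rightarrow> nat \<Rightarrow> 'y::finite \<Rightarrow> 'y \<Rightarrow> real" where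
  "path_max q x t m i j =
     Max ((\<lambda>y. \<Prod>k\<in>{t+1..m}. q (x (k - 1), y (k - 1)) (x k, y k)) `
          {y \<in> {t..m} \<rightarrow>\<^sub>E UNIV. y t = i \<and> y m = j})"

text \<open>For \<open>t = 1\<close> the product is empty and the value is \<open>p\<^sub>1 (x 1, i)\<close>.\<close>

definition viterbi_score ::
    "('x \<times> 'y \<Rightarrow> real) \<Rightarrow> ('x \<times> 'y \<Rightarrow> 'x \<times> 'y \<Rightarrow> real) \<Rightarrow> (nat \<Rightarrow> 'x) \<Rightarrow> nat \<Rightarrow> 'y::finite \<Rightarrow> real" where
  "viterbi_score p\<^sub>1 q x t i =
     Max ((\<lambda>y. p\<^sub>1 (x 1, y 1) * (\<Prod>k\<in>{2..t}. q (x (k - 1), y (k - 1)) (x k, y k))) `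
          {y \<in> {1..t} \<rightarrow>\<^sub>E UNIV. y t = i})"

definition node ::
    "('x \<times> 'y \<Rightarrow> real) \<Rightarrow> ('x \<times> 'y \<Rightarrow> 'x \<times> 'y \<Rightarrow> real) \<Rightarrow> (nat \<Rightarrow> 'x) \<Rightarrow> nat \<Rightarrow> nat \<Rightarrow> 'y::finite \<Rightarrow> bool" where
  "node p\<^sub>1 q x m t i \<longleftrightarrow> 1 \<le> t \<and> t < m \<and>
     (\<forall>j k. viterbi_score p\<^sub>1 q x t k * path_max q x t m k j
          \<le> viterbi_score p\<^sub>1 q x t i * path_max q x t m i j)"

definition strong_node ::
    "('x \<times> 'y \<Rightarrow> real) \<Rightarrow> ('x \<times> 'y \<Rightarrow> 'x \<times> 'y \<Rightarrow> real) \<Rightarrow> (nat \<Rightarrow> 'x) \<Rightarrow> nat \<Rightarrow> nat \<Rightarrow> 'y::finite \<Rightarrow> bool" where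
  "strong_node p\<^sub>1 q x m t i \<longleftrightarrow> node p\<^sub>1 q x m t i \<and>
     (\<forall>j k. k \<noteq> i \<longrightarrow> 0 < viterbi_score p\<^sub>1 q x t i * path_max q x t m i j \<longrightarrow>
        viterbi_score p\<^sub>1 q x t k * path_max q x t m k j
          < viterbi_score p\<^sub>1 q x t i * path_max q x t m i j)"

text \<open>\<open>\<X>\<^sup>M\<close> is represented by \<open>{1..M} \<rightarrow>\<^sub>E UNIV\<close>. The conjunct \<open>r < m\<close> says that \<open>m - r\<close> really is
  a time; without it truncated subtraction would enter.\<close>

definition strong_barrier ::
    "('x \<times> 'y \<Rightarrow> real) \<Rightarrow> ('x \<times> 'y \<Rightarrow> 'x \<times> 'y \<Rightarrow> real) \<Rightarrow> 'y::finite \<Rightarrow> nat \<Rightarrow> nat \<Rightarrow> (nat \<Rightarrow> 'x) \<Rightarrow> bool" where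
  "strong_barrier p\<^sub>1 q i r M b \<longleftrightarrow> b \<in> {1..M} \<rightarrow>\<^sub>E UNIV \<and>
     (\<forall>x m. M \<le> m \<and> (\<forall>l\<in>{1..M}. x (m - M + l) = b l) \<longrightarrow>
        r < m \<and> strong_node p\<^sub>1 q x m (m - r) i)"

definition infinitely_often ::
    "'w measure \<Rightarrow> (nat \<Rightarrow> 'w \<Rightarrow> 'x) \<Rightarrow> nat \<Rightarrow> (nat \<Rightarrow> 'x) set \<Rightarrow> 'w set" where
  "infinitely_often P X M S =
     (\<Inter>k\<in>{1..}. \<Union>l\<in>{k..}. {\<omega> \<in> space P. (\<lambda>n\<in>{1..M}. X (l + n - 1) \<omega>) \<in> S})"

end

theory Submission
  imports Defs
begin

text \<open>
  Write \<open>V t i\<close> for the Viterbi score and \<open>W t m i j\<close> for \<open>path_max\<close>. A block of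
  observations is a barrier as soon as it contains a long stretch on which one fixed state
  path \<open>a\<close> beats everything else at every single step. Suppose that the observation
  \<open>x k\<close> satisfies \<open>f i (x k) * col_max p i \<le> \<rho> * (f (a k) (x k) * col_max p (a k))\<close>
  for all \<open>i \<noteq> a k\<close>, with \<open>\<rho> < 1\<close>, and that \<open>p (a (k - 1)) (a k)\<close> is the largest entry of
  its column. Then every step into a state other than \<open>a k\<close> is worth at most \<open>\<rho>\<close> times the
  step along \<open>a\<close>. Hence a bound \<open>V t i \<le> B * V t (a t)\<close>, uniform in \<open>i\<close>, improves in one step
  to the constant \<open>max 1 (\<rho> * B)\<close>, and after sufficiently many steps the constant is \<open>1\<close>.
  One more step makes the inequality strict for all \<open>i \<noteq> a t\<close>. The
  same contraction, run backwards in time, gives \<open>W t m i j \<le> W t m (a t) j\<close>. Together the two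
  inequalities say that \<open>t\<close> is a strong node (\<open>strong_node_of_dominant_run\<close>).

  An initial constant \<open>B\<close> is what the cluster is for. An observation that is emitted
  with positive density exactly by the states of \<open>C\<close> forces every path of positive weight into
  \<open>C\<close>. By primitivity \<open>R\<close> further such observations let each state of \<open>C\<close>
  reach a fixed \<open>c \<in> C\<close>, and \<open>c\<close> reach each state of \<open>C\<close>, by paths of positive weight. So a
  competing path can be redirected onto the dominant run, or off it at the end, at the price of a
  bounded factor (\<open>viterbi_score_entry\<close>, \<open>path_max_exit\<close>). For this price to be
  independent of the observations, the observation sets are truncated so that the densities lie
  between \<open>1 / (K + 1)\<close> and \<open>K + 1\<close> wherever they are positive. Such a truncation keeps positive measure
  for large \<open>K\<close>.

  The dominant run is found by following, backwards from \<open>c\<close>, the state at which the maximum of the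
  current column is attained. By irreducibility its initial state can be reached from \<open>c\<close>
  in a number of steps that is bounded independently of the length of the run
  (\<open>dominant_excursion\<close>). This makes it possible to choose the length of the run last.

  The resulting set of barriers is a product of measurable sets, and some state path of positive
  probability emits each of its factors with positive probability. By irreducibility the chain can
  start this path soon, whatever its present state is, so that within a bounded
  time the block occurs with conditional probability at least \<open>w > 0\<close> given the past.
  The probability that it never occurs after a given time is thus at most \<open>(1 - w) ^ n\<close> for
  all \<open>n\<close> (\<open>pattern_eventually_occurs\<close>).
\<close>

section \<open>Maximal path weights\<close>

definition path_weight ::
    "('x \<times> 'y \<Rightarrow> 'x \<times> 'y \<Rightarrow> real) \<Rightarrow> (nat \<Rightarrow> 'x) \<Rightarrow> nat \<Rightarrow> nat \<Rightarrow> (nat \<Rightarrow> 'y) \<Rightarrow> real" where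
  "path_weight q x s u y = (\<Prod>k\<in>{s+1..u}. q (x (k - 1), y (k - 1)) (x k, y k))"

lemma path_weight_cong:
  "(\<And>k. s \<le> k \<Longrightarrow> k \<le> u \<Longrightarrow> y k = y' k) \<Longrightarrow> path_weight q x s u y = path_weight q x s u y'"
  unfolding path_weight_def by (intro prod.cong) auto

lemma path_weight_split:
  assumes "s \<le> t" "t \<le> u"
  shows "path_weight q x s u y = path_weight q x s t y * path_weight q x t u y"
proof -
  have "{s+1..u} = {s+1..t} \<union> {t+1..u}" "{s+1..t} \<inter> {t+1..u} = {}" using assms by auto
  then show ?thesis unfolding path_weight_def by (simp add: prod.union_disjoint)
qed

lemma path_weight_step [simp]: "path_weight q x s (Suc s) y = q (x s, y s) (x (Suc s), y (Suc s))"
  by (simp add: path_weight_def)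

lemma path_weight_nonneg: "(\<And>z z'. 0 \<le> q z z') \<Longrightarrow> 0 \<le> path_weight q x s u y"
  unfolding path_weight_def by (intro prod_nonneg) auto

lemma path_weight_le_power:
  assumes "\<And>z z'. 0 \<le> q z z'" "s \<le> u"
    and "\<And>k. s < k \<Longrightarrow> k \<le> u \<Longrightarrow> q (x (k - 1), y (k - 1)) (x k, y k) \<le> U"
  shows "path_weight q x s u y \<le> U ^ (u - s)"
proof -
  have "path_weight q x s u y \<le> (\<Prod>k\<in>{s+1..u}. U)"
    unfolding path_weight_def using assms by (intro prod_mono) auto
  then show ?thesis using assms(2) by simp
qed

lemma path_weight_ge_power:
  assumes "0 \<le> \<kappa>" "s \<le> u"
    and "\<And>k. s < k \<Longrightarrow> k \<le> u \<Longrightarrow> \<kappa> \<le> q (x (k - 1), y (k - 1)) (x k, y k)"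
  shows "\<kappa> ^ (u - s) \<le> path_weight q x s u y"
proof -
  have "(\<Prod>k\<in>{s+1..u}. \<kappa>) \<le> path_weight q x s u y"
    unfolding path_weight_def using assms by (intro prod_mono) auto
  then show ?thesis using assms(2) by simp
qed

lemma viterbi_score_ge:
  fixes y :: "nat \<Rightarrow> 'y::finite"
  assumes "1 \<le> t"
  shows "p\<^sub>1 (x 1, y 1) * path_weight q x 1 t y \<le> viterbi_score p\<^sub>1 q x t (y t)"
proof -
  let ?y = "restrict y {1..t}"
  have "finite ({1..t} \<rightarrow>\<^sub>E (UNIV :: 'y set))" by (intro finite_PiE) auto
  moreover have "p\<^sub>1 (x 1, y 1) * path_weight q x 1 t y = p\<^sub>1 (x 1, ?y 1) * path_weight q x 1 t ?y"
    using assms path_weight_cong[of 1 t y ?y q x] by simp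
  ultimately show ?thesis
    using assms unfolding viterbi_score_def path_weight_def
    by (intro Max_ge finite_imageI image_eqI[where x = ?y]) (auto simp: numeral_2_eq_2)
qed

lemma viterbi_score_attained:
  fixes i :: "'y::finite"
  assumes "1 \<le> t"
  obtains y where "y t = i" "viterbi_score p\<^sub>1 q x t i = p\<^sub>1 (x 1, y 1) * path_weight q x 1 t y"
proof -
  let ?A = "{y \<in> {1..t} \<rightarrow>\<^sub>E (UNIV :: 'y set). y t = i}"
  have "finite ({1..t} \<rightarrow>\<^sub>E (UNIV :: 'y set))" by (intro finite_PiE) auto
  moreover have "restrict (\<lambda>_. i) {1..t} \<in> ?A" using assms by auto
  then have "?A \<noteq> {}" by blast
  ultimately have "viterbi_score p\<^sub>1 q x t i \<in>
      (\<lambda>y. p\<^sub>1 (x 1, y 1) * (\<Prod>k\<in>{2..t}. q (x (k - 1), y (k - 1)) (x k, y k))) ` ?A"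
    unfolding viterbi_score_def by (intro Max_in finite_imageI) auto
  then show ?thesis using that unfolding path_weight_def by (auto simp: numeral_2_eq_2)
qed

lemma path_max_ge:
  fixes y :: "nat \<Rightarrow> 'y::finite"
  assumes "s \<le> m"
  shows "path_weight q x s m y \<le> path_max q x s m (y s) (y m)"
proof -
  let ?y = "restrict y {s..m}"
  have "finite ({s..m} \<rightarrow>\<^sub>E (UNIV :: 'y set))" by (intro finite_PiE) auto
  moreover have "path_weight q x s m y = path_weight q x s m ?y"
    using assms by (intro path_weight_cong) auto
  ultimately show ?thesis
    using assms unfolding path_max_def path_weight_def
    by (intro Max_ge finite_imageI image_eqI[where x = ?y]) auto
qed

lemma path_max_attained:
  fixes i j :: "'y::finite"
  assumes "s < m"
  obtains y where "y s = i" "y m = j" "path_max q x s m i j = path_weight q x s m y"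
proof -
  let ?A = "{y \<in> {s..m} \<rightarrow>\<^sub>E (UNIV :: 'y set). y s = i \<and> y m = j}"
  have "finite ({s..m} \<rightarrow>\<^sub>E (UNIV :: 'y set))" by (intro finite_PiE) auto
  moreover have "restrict (\<lambda>k. if k = s then i else j) {s..m} \<in> ?A" using assms by auto
  then have "?A \<noteq> {}" by blast
  ultimately have "path_max q x s m i j \<in>
      (\<lambda>y. \<Prod>k\<in>{s+1..m}. q (x (k - 1), y (k - 1)) (x k, y k)) ` ?A"
    unfolding path_max_def by (intro Max_in finite_imageI) auto
  then show ?thesis using that unfolding path_weight_def by auto
qed

lemma viterbi_score_nonneg:
  fixes i :: "'y::finite"
  assumes "\<And>z. 0 \<le> p\<^sub>1 z" "\<And>z z'. 0 \<le> q z z'" "1 \<le> t"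
  shows "0 \<le> viterbi_score p\<^sub>1 q x t i"
  by (rule viterbi_score_attained[OF assms(3), of i p\<^sub>1 q x])
    (simp add: assms path_weight_nonneg)

lemma path_max_nonneg:
  fixes i j :: "'y::finite"
  assumes "\<And>z z'. 0 \<le> q z z'" "s < m"
  shows "0 \<le> path_max q x s m i j"
  by (rule path_max_attained[OF assms(2), of i j q x]) (simp add: assms path_weight_nonneg)

text \<open>The scores obey the max-times analogue of the Chapman--Kolmogorov equation at every
  intermediate time: gluing paths gives the inequality \<open>\<ge>\<close>, and cutting an optimal path gives \<open>\<le>\<close>.
  All later estimates rest on these two inequalities and on their counterparts for \<open>path_max\<close>.\<close>

lemma viterbi_score_extend:
  fixes y :: "nat \<Rightarrow> 'y::finite"
  assumes "1 \<le> s" "s \<le> u"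
  shows "viterbi_score p\<^sub>1 q x s (y s) * path_weight q x s u y \<le> viterbi_score p\<^sub>1 q x u (y u)"
proof -
  obtain y0 where y0: "y0 s = y s"
    "viterbi_score p\<^sub>1 q x s (y s) = p\<^sub>1 (x 1, y0 1) * path_weight q x 1 s y0"
    using viterbi_score_attained[OF assms(1)] by metis
  define z where "z = (\<lambda>k. if k \<le> s then y0 k else y k)"
  have "path_weight q x 1 s y0 = path_weight q x 1 s z" "path_weight q x s u y = path_weight q x s u z"
    by (intro path_weight_cong; use y0(1) in \<open>auto simp: z_def\<close>)+
  then have "viterbi_score p\<^sub>1 q x s (y s) * path_weight q x s u y
      = p\<^sub>1 (x 1, z 1) * path_weight q x 1 u z"
    using y0 assms by (simp add: path_weight_split[of "Suc 0" s u] z_def)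
  moreover have "z u = y u" using y0(1) assms by (auto simp: z_def)
  ultimately show ?thesis using viterbi_score_ge[of u p\<^sub>1 x z q] assms by simp
qed

lemma viterbi_score_split:
  fixes j :: "'y::finite"
  assumes "\<And>z z'. 0 \<le> q z z'" "1 \<le> s" "s \<le> u"
  obtains y where "y u = j"
    "viterbi_score p\<^sub>1 q x u j \<le> viterbi_score p\<^sub>1 q x s (y s) * path_weight q x s u y"
proof -
  obtain y where y: "y u = j"
    "viterbi_score p\<^sub>1 q x u j = p\<^sub>1 (x 1, y 1) * path_weight q x 1 u y"
    using viterbi_score_attained[of u j p\<^sub>1 q x] assms by auto
  have "viterbi_score p\<^sub>1 q x u j
      = (p\<^sub>1 (x 1, y 1) * path_weight q x 1 s y) * path_weight q x s u y"
    using y assms by (simp add: path_weight_split[of "Suc 0" s u])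
  also have "\<dots> \<le> viterbi_score p\<^sub>1 q x s (y s) * path_weight q x s u y"
    using assms by (intro mult_right_mono viterbi_score_ge path_weight_nonneg) auto
  finally show ?thesis using that y by blast
qed

lemma path_max_extend:
  fixes y :: "nat \<Rightarrow> 'y::finite"
  assumes "s \<le> u" "u < m"
  shows "path_weight q x s u y * path_max q x u m (y u) j \<le> path_max q x s m (y s) j"
proof -
  obtain y0 where y0: "y0 u = y u" "y0 m = j" "path_max q x u m (y u) j = path_weight q x u m y0"
    using path_max_attained[OF assms(2), of "y u" j q x] by metis
  define z where "z = (\<lambda>k. if k \<le> u then y k else y0 k)"
  have "path_weight q x s u y = path_weight q x s u z" "path_weight q x u m y0 = path_weight q x u m z"
    by (intro path_weight_cong; use y0(1) in \<open>auto simp: z_def\<close>)+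
  then have "path_weight q x s u y * path_max q x u m (y u) j = path_weight q x s m z"
    using y0 assms by (simp add: path_weight_split[of s u m])
  moreover have "z s = y s" "z m = j" using y0 assms by (auto simp: z_def)
  ultimately show ?thesis using path_max_ge[of s m q x z] assms by simp
qed

lemma path_max_split:
  fixes i j :: "'y::finite"
  assumes "\<And>z z'. 0 \<le> q z z'" "s \<le> u" "u < m"
  obtains y where "y s = i"
    "path_max q x s m i j \<le> path_weight q x s u y * path_max q x u m (y u) j"
proof -
  obtain y where y: "y s = i" "y m = j" "path_max q x s m i j = path_weight q x s m y"
    using path_max_attained[of s m i j q x] assms by auto
  have "path_max q x s m i j = path_weight q x s u y * path_weight q x u m y"
    using y assms by (simp add: path_weight_split[of s u m])
  also have "\<dots> \<le> path_weight q x s u y * path_max q x u m (y u) j"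
    using assms path_max_ge[of u m q x y] y by (intro mult_left_mono path_weight_nonneg) auto
  finally show ?thesis using that y by blast
qed

section \<open>Dominant runs force strong nodes\<close>

text \<open>Here \<open>g i j\<close> is the weight of a step from \<open>i\<close> to \<open>j\<close>. The step from \<open>a\<close> to \<open>b\<close> need only be
  maximal among the steps into \<open>b\<close>, since several states may share the maximal transition
  probability. The factor \<open>\<rho>\<close> is gained against steps into all other states.\<close>

definition dominant_step :: "real \<Rightarrow> ('y \<Rightarrow> 'y \<Rightarrow> real) \<Rightarrow> 'y \<Rightarrow> 'y \<Rightarrow> bool" where
  "dominant_step \<rho> g a b \<longleftrightarrow> (\<forall>i. g i b \<le> g a b) \<and> (\<forall>i j. j \<noteq> b \<longrightarrow> g i j \<le> \<rho> * g a b)"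

lemma viterbi_score_dominant_step:
  fixes i :: "'y::finite"
  assumes p1: "\<And>z. 0 \<le> p\<^sub>1 z" and q: "\<And>z z'. 0 \<le> q z z'" and t: "1 \<le> t" and "0 \<le> B" "0 \<le> \<rho>"
    and dom: "dominant_step \<rho> (\<lambda>i j. q (x t, i) (x (Suc t), j)) a b"
    and le: "\<And>i. viterbi_score p\<^sub>1 q x t i \<le> B * viterbi_score p\<^sub>1 q x t a"
    and "j \<noteq> b"
  shows "viterbi_score p\<^sub>1 q x (Suc t) j \<le> \<rho> * B * viterbi_score p\<^sub>1 q x (Suc t) b"
proof -
  let ?V = "viterbi_score p\<^sub>1 q x"
  note nn = viterbi_score_nonneg[of p\<^sub>1 q, OF p1 q]
  obtain y where y: "y (Suc t) = j" "?V (Suc t) j \<le> ?V t (y t) * q (x t, y t) (x (Suc t), j)"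
    using viterbi_score_split[of q t "Suc t" j p\<^sub>1 x] q t by (metis le_SucI le_refl path_weight_step)
  note y(2)
  also have "\<dots> \<le> (B * ?V t a) * (\<rho> * q (x t, a) (x (Suc t), b))"
    using dom le q nn[OF t] \<open>j \<noteq> b\<close> assms(4) t unfolding dominant_step_def
    by (intro mult_mono) auto
  also have "\<dots> = \<rho> * B * (?V t a * q (x t, a) (x (Suc t), b))" by simp
  also have "\<dots> \<le> \<rho> * B * ?V (Suc t) b"
    using viterbi_score_extend[of t "Suc t" p\<^sub>1 q x "\<lambda>k. if k = t then a else b"] t assms(4,5)
    by (intro mult_left_mono) auto
  finally show ?thesis .
qed

text \<open>Backwards in time there is no strict gain at the starting state \<open>i\<close>. An optimal
  continuation whose first step leads to \<open>b\<close> can start from \<open>a\<close> at no loss, and any other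
  continuation loses the factor \<open>\<rho>\<close>.\<close>

lemma path_max_dominant_step:
  fixes i :: "'y::finite"
  assumes q: "\<And>z z'. 0 \<le> q z z'" and t: "Suc t < m" and "0 \<le> B" "0 \<le> \<rho>"
    and dom: "dominant_step \<rho> (\<lambda>i j. q (x t, i) (x (Suc t), j)) a b"
    and le: "\<And>i. path_max q x (Suc t) m i j \<le> B * path_max q x (Suc t) m b j"
  shows "path_max q x t m i j \<le> max 1 (\<rho> * B) * path_max q x t m a j"
proof -
  let ?W = "\<lambda>t i. path_max q x t m i j"
  note nn = path_max_nonneg[of q, OF q]
  have ext: "q (x t, a) (x (Suc t), b) * ?W (Suc t) b \<le> ?W t a"
    using path_max_extend[of t "Suc t" m q x "\<lambda>k. if k = t then a else b"] t by simp
  obtain y where y: "y t = i" "?W t i \<le> q (x t, i) (x (Suc t), y (Suc t)) * ?W (Suc t) (y (Suc t))"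
    using path_max_split[of q t "Suc t" m i x j] q t by (metis le_SucI le_refl path_weight_step)
  show ?thesis
  proof (cases "y (Suc t) = b")
    case True
    have "?W t i \<le> q (x t, a) (x (Suc t), b) * ?W (Suc t) b"
      using y(2) True dom nn t unfolding dominant_step_def
      by (meson mult_right_mono order_trans)
    also have "\<dots> \<le> 1 * ?W t a" using ext by simp
    also have "\<dots> \<le> max 1 (\<rho> * B) * ?W t a" using nn t by (intro mult_right_mono) auto
    finally show ?thesis .
  next
    case False
    note y(2)
    also have "q (x t, i) (x (Suc t), y (Suc t)) * ?W (Suc t) (y (Suc t))
        \<le> (\<rho> * q (x t, a) (x (Suc t), b)) * (B * ?W (Suc t) b)"
      using dom False le q nn t assms(4) unfolding dominant_step_def by (intro mult_mono) auto
    also have "\<dots> = \<rho> * B * (q (x t, a) (x (Suc t), b) * ?W (Suc t) b)" by simp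
    also have "\<dots> \<le> \<rho> * B * ?W t a" using ext assms by (intro mult_left_mono) auto
    also have "\<dots> \<le> max 1 (\<rho> * B) * ?W t a" using nn t by (intro mult_right_mono) auto
    finally show ?thesis .
  qed
qed

lemma max_one_power_step:
  assumes "0 \<le> \<rho>" "\<rho> \<le> (1::real)" "0 \<le> B"
  shows "max 1 (\<rho> * max 1 (\<rho> ^ n * B)) = max 1 (\<rho> ^ Suc n * B)"
proof (cases "\<rho> ^ n * B \<le> 1")
  case True
  then have "\<rho> * (\<rho> ^ n * B) \<le> 1" using mult_mono[of \<rho> 1 "\<rho> ^ n * B" 1] assms by simp
  then show ?thesis using True assms by (simp add: max_absorb1 mult.assoc)
next
  case False
  then show ?thesis by (simp add: max_def mult.assoc)
qed

text \<open>Each step multiplies the comparison constant by \<open>\<rho>\<close> until it reaches \<open>1\<close>. It cannot drop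
  below \<open>1\<close> because \<open>i\<close> may be the state of the run itself.\<close>

lemma viterbi_score_dominant_run:
  fixes a :: "nat \<Rightarrow> 'y::finite"
  assumes p1: "\<And>z. 0 \<le> p\<^sub>1 z" and q: "\<And>z z'. 0 \<le> q z z'" and s: "1 \<le> s"
    and B: "0 \<le> B" and \<rho>: "0 \<le> \<rho>" "\<rho> \<le> 1"
    and dom: "\<And>k. s < k \<Longrightarrow> k \<le> s + n \<Longrightarrow>
                dominant_step \<rho> (\<lambda>i j. q (x (k - 1), i) (x k, j)) (a (k - 1)) (a k)"
    and le: "\<And>i. viterbi_score p\<^sub>1 q x s i \<le> B * viterbi_score p\<^sub>1 q x s (a s)"
  shows "viterbi_score p\<^sub>1 q x (s + n) i
           \<le> max 1 (\<rho> ^ n * B) * viterbi_score p\<^sub>1 q x (s + n) (a (s + n))"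
  using dom
proof (induction n arbitrary: i)
  case 0
  have "B * viterbi_score p\<^sub>1 q x s (a s) \<le> max 1 B * viterbi_score p\<^sub>1 q x s (a s)"
    using viterbi_score_nonneg[of p\<^sub>1 q, OF p1 q s] by (intro mult_right_mono) auto
  then show ?case using le[of i] by simp
next
  case (Suc n)
  let ?V = "viterbi_score p\<^sub>1 q x"
  have nn: "0 \<le> ?V (Suc (s + n)) j" for j using viterbi_score_nonneg[of p\<^sub>1 q, OF p1 q] by simp
  show ?case
  proof (cases "i = a (Suc (s + n))")
    case True
    have "1 * ?V (Suc (s + n)) i \<le> max 1 (\<rho> ^ Suc n * B) * ?V (Suc (s + n)) i"
      using nn by (intro mult_right_mono) auto
    then show ?thesis using True by simp
  next
    case False
    have d: "dominant_step \<rho> (\<lambda>i j. q (x (s + n), i) (x (Suc (s + n)), j)) (a (s + n)) (a (Suc (s + n)))"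
      using Suc.prems[of "Suc (s + n)"] by simp
    have "?V (Suc (s + n)) i \<le> \<rho> * max 1 (\<rho> ^ n * B) * ?V (Suc (s + n)) (a (Suc (s + n)))"
      by (rule viterbi_score_dominant_step[OF p1 q _ _ \<rho>(1) d Suc.IH False])
        (use s Suc.prems in auto)
    also have "\<dots> \<le> max 1 (\<rho> * max 1 (\<rho> ^ n * B)) * ?V (Suc (s + n)) (a (Suc (s + n)))"
      using nn by (intro mult_right_mono) auto
    finally show ?thesis using max_one_power_step[OF \<rho> B] by simp
  qed
qed

lemma path_max_dominant_run:
  fixes a :: "nat \<Rightarrow> 'y::finite"
  assumes q: "\<And>z z'. 0 \<le> q z z'" and "t + n < m"
    and B: "0 \<le> B" and \<rho>: "0 \<le> \<rho>" "\<rho> \<le> 1"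
    and dom: "\<And>k. t < k \<Longrightarrow> k \<le> t + n \<Longrightarrow>
                dominant_step \<rho> (\<lambda>i j. q (x (k - 1), i) (x k, j)) (a (k - 1)) (a k)"
    and le: "\<And>i. path_max q x (t + n) m i j \<le> B * path_max q x (t + n) m (a (t + n)) j"
  shows "path_max q x t m i j \<le> max 1 (\<rho> ^ n * B) * path_max q x t m (a t) j"
  using assms(2) dom le
proof (induction n arbitrary: t i)
  case 0
  have "B * path_max q x t m (a t) j \<le> max 1 B * path_max q x t m (a t) j"
    using path_max_nonneg[of q, OF q] 0 by (intro mult_right_mono) auto
  then show ?case using 0(3)[of i] by simp
next
  case (Suc n)
  have *: "path_max q x (Suc t) m i j \<le> max 1 (\<rho> ^ n * B) * path_max q x (Suc t) m (a (Suc t)) j" for i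
    by (rule Suc.IH) (use Suc.prems in auto)
  have d: "dominant_step \<rho> (\<lambda>i j. q (x t, i) (x (Suc t), j)) (a t) (a (Suc t))"
    using Suc.prems(2)[of "Suc t"] by simp
  have "path_max q x t m i j \<le> max 1 (\<rho> * max 1 (\<rho> ^ n * B)) * path_max q x t m (a t) j"
    by (rule path_max_dominant_step[OF q _ _ \<rho>(1) d *]) (use Suc.prems in auto)
  then show ?case by (simp only: max_one_power_step[OF \<rho> B])
qed

text \<open>The first \<open>n\<close> steps of the run bring the constant of the forward comparison down to \<open>1\<close>,
  the step after them makes that comparison strict, and the last \<open>n'\<close> steps serve the
  backward comparison. Strictness of the forward part is enough, as the product of the two
  comparisons is strict wherever its larger side is positive.\<close>

lemma strong_node_of_dominant_run:
  fixes a :: "nat \<Rightarrow> 'y::finite"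
  assumes p1: "\<And>z. 0 \<le> p\<^sub>1 z" and q: "\<And>z z'. 0 \<le> q z z'"
    and time: "1 \<le> s" "s + n + 1 + n' < m"
    and B: "0 \<le> B" and \<rho>: "0 \<le> \<rho>" "\<rho> < 1"
    and dom: "\<And>k. s < k \<Longrightarrow> k \<le> s + n + 1 + n' \<Longrightarrow>
                dominant_step \<rho> (\<lambda>i j. q (x (k - 1), i) (x k, j)) (a (k - 1)) (a k)"
    and entry: "\<And>i. viterbi_score p\<^sub>1 q x s i \<le> B * viterbi_score p\<^sub>1 q x s (a s)"
    and exit: "\<And>i j. path_max q x (s + n + 1 + n') m i j
                 \<le> B * path_max q x (s + n + 1 + n') m (a (s + n + 1 + n')) j"
    and small: "\<rho> ^ n * B \<le> 1" "\<rho> ^ n' * B \<le> 1"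
  shows "strong_node p\<^sub>1 q x m (s + n + 1) (a (s + n + 1))"
proof -
  let ?V = "viterbi_score p\<^sub>1 q x" and ?W = "path_max q x"
  define t where "t = Suc (s + n)"
  have \<rho>1: "\<rho> \<le> 1" using \<rho> by simp
  have nnV: "0 \<le> ?V t i" for i using viterbi_score_nonneg[of p\<^sub>1 q, OF p1 q] by (simp add: t_def)
  have nnW: "0 \<le> ?W t m i j" for i j using path_max_nonneg[of q, OF q] time by (simp add: t_def)
  have before: "?V (s + n) i \<le> 1 * ?V (s + n) (a (s + n))" for i
    using viterbi_score_dominant_run[OF p1 q time(1) B \<rho>(1) \<rho>1 dom entry, of n i] small by simp
  have d: "dominant_step \<rho> (\<lambda>i j. q (x (s + n), i) (x (Suc (s + n)), j)) (a (s + n)) (a (Suc (s + n)))"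
    using dom[of "Suc (s + n)"] by simp
  have V: "?V t k \<le> \<rho> * ?V t (a t)" if "k \<noteq> a t" for k
    using viterbi_score_dominant_step[OF p1 q _ _ \<rho>(1) d before] that time by (simp add: t_def)
  have W: "?W t m k j \<le> ?W t m (a t) j" for k j
    using path_max_dominant_run[of q t n' m B \<rho> x a j k] q time B \<rho> \<rho>1 dom exit small
    by (simp add: t_def)
  have VW: "?V t k * ?W t m k j \<le> \<rho> * (?V t (a t) * ?W t m (a t) j)" if "k \<noteq> a t" for k j
    using mult_mono[OF V[OF that] W[of k j]] nnV nnW \<rho> by (simp add: mult.assoc)
  have contr: "\<rho> * c \<le> c" "0 < c \<Longrightarrow> \<rho> * c < c" if "0 \<le> c" for c
    using \<rho> that by (auto simp: mult_left_le_one_le)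
  have "strong_node p\<^sub>1 q x m t (a t)"
    unfolding strong_node_def node_def
  proof (intro conjI allI impI)
    show "1 \<le> t" "t < m" using time by (auto simp: t_def)
    show "?V t k * ?W t m k j \<le> ?V t (a t) * ?W t m (a t) j" for j k
    proof (cases "k = a t")
      case False
      then show ?thesis using VW[OF False, of j] contr(1) nnV nnW by (meson mult_nonneg_nonneg order_trans)
    qed simp
    show "?V t k * ?W t m k j < ?V t (a t) * ?W t m (a t) j"
      if "k \<noteq> a t" "0 < ?V t (a t) * ?W t m (a t) j" for j k
      using VW[OF that(1), of j] contr(2)[OF _ that(2)] that(2) by linarith
  qed
  then show ?thesis by (simp add: t_def)
qed

text \<open>An optimal path to \<open>i\<close> at time \<open>s\<close> of positive weight is, at time \<open>w\<close>, in a state from which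
  \<open>a\<close> can be reached. Following it only up to time \<open>w\<close> and then moving to \<open>a\<close> costs at most a factor
  \<open>U / \<kappa>\<close> per step. The time \<open>w\<close> is at least \<open>2\<close> since at time \<open>1\<close> the score is the
  initial density, which may charge states that do not emit \<open>x 1\<close> under \<open>q\<close>.\<close>

lemma viterbi_score_entry:
  fixes a i :: "'y::finite"
  assumes p1: "\<And>z. 0 \<le> p\<^sub>1 z" and q: "\<And>z z'. 0 \<le> q z z'"
    and ws: "2 \<le> w" "w \<le> s" and pos: "0 < \<kappa>" "0 < U"
    and upper: "\<And>k i j. w < k \<Longrightarrow> k \<le> s \<Longrightarrow> q (x (k - 1), i) (x k, j) \<le> U"
    and path: "\<And>j z. 0 < q z (x w, j) \<Longrightarrow>
      \<exists>y. y w = j \<and> y s = a \<and> (\<forall>k. w < k \<longrightarrow> k \<le> s \<longrightarrow> \<kappa> \<le> q (x (k - 1), y (k - 1)) (x k, y k))"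
  shows "viterbi_score p\<^sub>1 q x s i \<le> (U / \<kappa>) ^ (s - w) * viterbi_score p\<^sub>1 q x s a"
proof -
  let ?V = "viterbi_score p\<^sub>1 q x"
  note nn = viterbi_score_nonneg[of p\<^sub>1 q, OF p1 q]
  obtain y where y: "y s = i" "?V s i \<le> ?V w (y w) * path_weight q x w s y"
    using viterbi_score_split[of q w s i p\<^sub>1 x] q ws by (metis order_trans one_le_numeral)
  note y(2)
  also have "?V w (y w) * path_weight q x w s y \<le> ?V w (y w) * U ^ (s - w)"
    using path_weight_le_power[of q w s x y U] q ws upper nn[of w]
    by (intro mult_left_mono) auto
  finally have up: "?V s i \<le> ?V w (y w) * U ^ (s - w)" .
  show ?thesis
  proof (cases "\<exists>z. 0 < q z (x w, y w)")
    case True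
    then obtain y' where y': "y' w = y w" "y' s = a"
      "\<And>k. w < k \<Longrightarrow> k \<le> s \<Longrightarrow> \<kappa> \<le> q (x (k - 1), y' (k - 1)) (x k, y' k)"
      using path by blast
    have "?V w (y w) * \<kappa> ^ (s - w) \<le> ?V w (y w) * path_weight q x w s y'"
      using path_weight_ge_power[of \<kappa> w s q x y'] y' pos ws nn[of w] by (intro mult_left_mono) auto
    also have "\<dots> \<le> ?V s a" using viterbi_score_extend[of w s p\<^sub>1 q x y'] y' ws by simp
    finally have "(U / \<kappa>) ^ (s - w) * (?V w (y w) * \<kappa> ^ (s - w)) \<le> (U / \<kappa>) ^ (s - w) * ?V s a"
      using pos by (intro mult_left_mono) auto
    then show ?thesis using up pos by (simp add: power_divide mult.commute)
  next
    case False
    then have zero: "q z (x w, y w) = 0" for z using q by (meson antisym not_le)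
    obtain y0 where y0: "y0 w = y w"
      "?V w (y w) \<le> ?V (w - 1) (y0 (w - 1)) * path_weight q x (w - 1) w y0"
      by (rule viterbi_score_split[where q = q and s = "w - 1" and u = w and j = "y w"]) (use q ws in auto)
    have "path_weight q x (w - 1) w y0 = 0"
      using path_weight_step[of q x "w - 1" y0] zero y0 ws by simp
    then have "?V s i \<le> 0" using up y0(2) nn[of w x "y w"] ws by simp
    also have "0 \<le> (U / \<kappa>) ^ (s - w) * ?V s a" using pos nn[of s] ws by simp
    finally show ?thesis .
  qed
qed

lemma path_max_exit:
  fixes a i j :: "'y::finite"
  assumes q: "\<And>z z'. 0 \<le> q z z'" and um: "u < m" and pos: "0 < \<kappa>" "0 < U"
    and upper: "\<And>k i j. u < k \<Longrightarrow> k \<le> m \<Longrightarrow> q (x (k - 1), i) (x k, j) \<le> U"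
    and path: "\<And>z. 0 < q z (x m, j) \<Longrightarrow>
      \<exists>y. y u = a \<and> y m = j \<and> (\<forall>k. u < k \<longrightarrow> k \<le> m \<longrightarrow> \<kappa> \<le> q (x (k - 1), y (k - 1)) (x k, y k))"
  shows "path_max q x u m i j \<le> (U / \<kappa>) ^ (m - u) * path_max q x u m a j"
proof -
  let ?W = "path_max q x u m"
  note nn = path_max_nonneg[of q, OF q um]
  obtain y where y: "y u = i" "y m = j" "?W i j = path_weight q x u m y"
    using path_max_attained[of u m i j q x] um by auto
  show ?thesis
  proof (cases "\<exists>z. 0 < q z (x m, j)")
    case True
    then obtain y' where y': "y' u = a" "y' m = j"
      "\<And>k. u < k \<Longrightarrow> k \<le> m \<Longrightarrow> \<kappa> \<le> q (x (k - 1), y' (k - 1)) (x k, y' k)"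
      using path by blast
    have "\<kappa> ^ (m - u) \<le> path_weight q x u m y'"
      using path_weight_ge_power[of \<kappa> u m q x y'] y' pos um by auto
    also have "\<dots> \<le> ?W a j" using path_max_ge[of u m q x y'] y' um by simp
    finally have "(U / \<kappa>) ^ (m - u) * \<kappa> ^ (m - u) \<le> (U / \<kappa>) ^ (m - u) * ?W a j"
      using pos by (intro mult_left_mono) auto
    moreover have "?W i j \<le> U ^ (m - u)"
      using path_weight_le_power[of q u m x y U] q um upper y by auto
    ultimately show ?thesis using pos by (simp add: power_divide)
  next
    case False
    then have zero: "q z (x m, j) = 0" for z using q by (meson antisym not_le)
    have "path_weight q x u m y = path_weight q x u (m - 1) y * path_weight q x (m - 1) m y"
      using um by (intro path_weight_split) auto
    moreover have "path_weight q x (m - 1) m y = 0"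
      using path_weight_step[of q x "m - 1" y] zero y um by simp
    ultimately have "?W i j = 0" using y by simp
    then show ?thesis using nn pos by simp
  qed
qed

section \<open>Paths of positive probability\<close>

text \<open>The sets \<open>E k\<close> prescribe which states are acceptable at time \<open>k\<close>. They will be the states
  that emit the observations of the barrier with density bounded away from \<open>0\<close>.
  The time \<open>s\<close> itself carries no such condition, so that linked pieces can be concatenated.\<close>

definition linked ::
    "('y \<Rightarrow> 'y \<Rightarrow> real) \<Rightarrow> (nat \<Rightarrow> 'y set) \<Rightarrow> nat \<Rightarrow> nat \<Rightarrow> 'y \<Rightarrow> 'y \<Rightarrow> bool" where
  "linked p E s u i j \<longleftrightarrow>
     (\<exists>y. y s = i \<and> y u = j \<and> (\<forall>k. s < k \<longrightarrow> k \<le> u \<longrightarrow> 0 < p (y (k - 1)) (y k) \<and> y k \<in> E k))"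

lemma linkedI:
  assumes "y s = i" "y u = j"
    and "\<And>k. s < k \<Longrightarrow> k \<le> u \<Longrightarrow> 0 < p (y (k - 1)) (y k)" "\<And>k. s < k \<Longrightarrow> k \<le> u \<Longrightarrow> y k \<in> E k"
  shows "linked p E s u i j"
  using assms unfolding linked_def by blast

lemma linked_trans:
  assumes "linked p E s t i j" "linked p E t u j k" "s \<le> t" "t \<le> u"
  shows "linked p E s u i k"
proof -
  obtain y where y: "y s = i" "y t = j"
    "\<And>l. s < l \<Longrightarrow> l \<le> t \<Longrightarrow> 0 < p (y (l - 1)) (y l) \<and> y l \<in> E l"
    using assms(1) unfolding linked_def by blast
  obtain y' where y': "y' t = j" "y' u = k"
    "\<And>l. t < l \<Longrightarrow> l \<le> u \<Longrightarrow> 0 < p (y' (l - 1)) (y' l) \<and> y' l \<in> E l"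
    using assms(2) unfolding linked_def by blast
  define z where "z = (\<lambda>l. if l \<le> t then y l else y' l)"
  have z': "z l = y' l" if "t \<le> l" for l using that y y' by (auto simp: z_def)
  show ?thesis
  proof (rule linkedI[of z])
    show "z s = i" "z u = k" using y y' z' assms by (auto simp: z_def)
    fix l assume l: "s < l" "l \<le> u"
    have "0 < p (z (l - 1)) (z l) \<and> z l \<in> E l"
    proof (cases "l \<le> t")
      case True
      then have "l - 1 \<le> t" by simp
      then show ?thesis using y(3)[of l] l True by (simp add: z_def)
    next
      case False
      then show ?thesis using y'(3)[of l] l z'[of l] z'[of "l - 1"] by simp
    qed
    then show "0 < p (z (l - 1)) (z l)" "z l \<in> E l" by auto
  qed
qed

lemma submatrix_power_nonneg:
  "(\<And>i j. 0 \<le> p i j) \<Longrightarrow> 0 \<le> submatrix_power C p n i j"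
  by (induction n arbitrary: j) (auto intro!: sum_nonneg)

lemma linked_of_submatrix_power:
  assumes p: "\<And>i j. 0 \<le> p i j" and "0 < submatrix_power C p n i j" "j \<in> C"
    and "\<And>k. s < k \<Longrightarrow> k \<le> s + n \<Longrightarrow> C \<subseteq> E k"
  shows "linked p E s (s + n) i j"
  using assms(2-)
proof (induction n arbitrary: j)
  case 0
  then show ?case by (auto simp: linked_def split: if_splits)
next
  case (Suc n)
  have "(\<Sum>k\<in>C. submatrix_power C p n i k * p k j) \<noteq> 0" using Suc.prems(1) by simp
  then obtain k where k: "k \<in> C" "submatrix_power C p n i k * p k j \<noteq> 0"
    by (meson sum.neutral)
  then have pos: "0 < submatrix_power C p n i k" "0 < p k j"
    using p submatrix_power_nonneg[of p C n i k] by (auto simp: less_le)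
  have "linked p E s (s + n) i k" using Suc.IH[OF pos(1) k(1)] Suc.prems(3) by simp
  moreover have "linked p E (s + n) (s + Suc n) k j"
    by (rule linkedI[of "\<lambda>l. if l = s + n then k else j"])
      (use pos Suc.prems(2) Suc.prems(3)[of "s + Suc n"] in \<open>auto simp: le_Suc_eq\<close>)
  ultimately show ?case by (rule linked_trans) auto
qed

lemma col_max_attained: "\<exists>i. p i j = col_max p (j :: 'y::finite)"
  using Max_in[of "range (\<lambda>i. p i j)"] unfolding col_max_def by fastforce

lemma le_col_max: "p i j \<le> col_max p (j :: 'y::finite)"
  unfolding col_max_def by (intro Max_ge) auto

lemma col_max_pos:
  assumes "\<And>i j. 0 \<le> p i j" "irreducible_matrix p"
  shows "0 < col_max p (j :: 'y::finite)"
proof -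
  obtain n where n: "n \<ge> 1" "0 < submatrix_power UNIV p n j j"
    using assms(2) unfolding irreducible_matrix_def by blast
  obtain y where "\<And>k. 0 < k \<Longrightarrow> k \<le> n \<Longrightarrow> 0 < p (y (k - 1)) (y k)" "y n = j"
    using linked_of_submatrix_power[of p UNIV n j j 0 "\<lambda>_. UNIV"] assms(1) n
    unfolding linked_def by auto
  then have "0 < p (y (n - 1)) j" using n by force
  then show ?thesis using le_col_max[of p "y (n - 1)" j] by linarith
qed

lemma irreducible_linked:
  assumes "\<And>i j. 0 \<le> p i j" "irreducible_matrix (p :: 'y::finite \<Rightarrow> 'y \<Rightarrow> real)"
  shows "\<exists>D. \<forall>i j. \<exists>n. 1 \<le> n \<and> n \<le> D \<and> linked p (\<lambda>_. UNIV) 0 n i j"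
proof -
  have "\<forall>ij. \<exists>n. 1 \<le> n \<and> linked p (\<lambda>_. UNIV) 0 n (fst ij) (snd ij)"
    using assms linked_of_submatrix_power[of p UNIV _ _ _ 0 "\<lambda>_. UNIV"]
    unfolding irreducible_matrix_def by fastforce
  then obtain n where n: "\<And>ij. 1 \<le> n ij \<and> linked p (\<lambda>_. UNIV) 0 (n ij) (fst ij) (snd ij)"
    by metis
  have "n ij \<le> Max (range n)" for ij by (intro Max_ge) auto
  then show ?thesis using n by (metis fst_conv snd_conv)
qed

text \<open>The run is constructed backwards from its final state \<open>c\<close>, so its first state depends on
  its length \<open>L\<close>. What matters is that the length \<open>n\<close> of the approach is bounded
  by a constant independent of \<open>L\<close>: the approach determines the cost that a run of
  length \<open>L\<close> has to make up for. Ending the run in \<open>c\<close> avoids a second connecting path.\<close>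

lemma dominant_excursion:
  assumes p: "\<And>i j. 0 \<le> p i j" and "irreducible_matrix (p :: 'y::finite \<Rightarrow> 'y \<Rightarrow> real)"
  shows "\<exists>D::nat. \<forall>c L. \<exists>n g. n \<le> D \<and> g 0 = c \<and> g (n + L) = c \<and>
      (\<forall>k. 0 < k \<longrightarrow> k \<le> n + L \<longrightarrow> 0 < p (g (k - 1)) (g k)) \<and>
      (\<forall>k. n < k \<longrightarrow> k \<le> n + L \<longrightarrow> p (g (k - 1)) (g k) = col_max p (g k))"
proof -
  obtain D where D: "\<And>i j. \<exists>n. 1 \<le> n \<and> n \<le> D \<and> linked p (\<lambda>_. UNIV) 0 n i j"
    using irreducible_linked[OF p assms(2)] by blast
  obtain pred where pred: "\<And>j. p (pred j) j = col_max p j" using col_max_attained[of p] by metis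
  have excursion: "\<exists>n g. n \<le> D \<and> g 0 = c \<and> g (n + L) = c \<and>
      (\<forall>k. 0 < k \<longrightarrow> k \<le> n + L \<longrightarrow> 0 < p (g (k - 1)) (g k)) \<and>
      (\<forall>k. n < k \<longrightarrow> k \<le> n + L \<longrightarrow> p (g (k - 1)) (g k) = col_max p (g k))" for c L
  proof -
    define a where "a = (\<lambda>k. (pred ^^ (L - k)) c)"
    obtain n y where n: "n \<le> D" and y: "y 0 = c" "y n = a 0"
      "\<And>k. 0 < k \<Longrightarrow> k \<le> n \<Longrightarrow> 0 < p (y (k - 1)) (y k)"
      using D[of c "a 0"] unfolding linked_def by auto
    define g where "g = (\<lambda>k. if k \<le> n then y k else a (k - n))"
    have g: "g k = a (k - n)" if "n \<le> k" for k using that y by (auto simp: g_def)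
    have run: "p (g (k - 1)) (g k) = col_max p (g k)" if "n < k" "k \<le> n + L" for k
    proof -
      have "L - (k - 1 - n) = Suc (L - (k - n))" using that by simp
      then have "g (k - 1) = pred (g k)" using that by (simp add: g a_def)
      then show ?thesis using pred by simp
    qed
    have pos: "0 < p (g (k - 1)) (g k)" if "0 < k" "k \<le> n + L" for k
    proof (cases "k \<le> n")
      case True
      then have "k - 1 \<le> n" by simp
      then show ?thesis using y(3)[of k] that True by (simp add: g_def)
    next
      case False
      then show ?thesis using run[of k] that col_max_pos[OF p assms(2)] by simp
    qed
    have "g 0 = c" "g (n + L) = c" using y g[of "n + L"] by (simp_all add: g_def a_def)
    then show ?thesis using n run pos by blast
  qed
  show ?thesis by (rule exI[of _ D]) (intro allI excursion)
qed

section \<open>Barriers\<close>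

lemma hmm_q_apply [simp]: "hmm_q p f (x', i) (x, j) = p i j * f j x"
  by (simp add: hmm_q_def)

text \<open>Comparing with \<open>col_max\<close> decouples the two factors of \<open>p i j * f j x\<close>: maximality of the
  transition takes care of steps into \<open>b\<close>, the domination hypothesis of all others.\<close>

lemma dominant_step_hmm:
  fixes p :: "'y::finite \<Rightarrow> 'y \<Rightarrow> real"
  assumes f: "\<And>j x. 0 \<le> f j x" and a: "p a b = col_max p b"
    and dom: "\<And>j. j \<noteq> b \<Longrightarrow> f j x * col_max p j \<le> \<rho> * (f b x * col_max p b)"
  shows "dominant_step \<rho> (\<lambda>i j. hmm_q p f (x', i) (x, j)) a b"
  unfolding dominant_step_def
proof (intro conjI allI impI)
  show "hmm_q p f (x', i) (x, b) \<le> hmm_q p f (x', a) (x, b)" for i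
    using le_col_max[of p i b] a f by (simp add: mult_right_mono)
  show "hmm_q p f (x', i) (x, j) \<le> \<rho> * hmm_q p f (x', a) (x, b)" if "j \<noteq> b" for i j
  proof -
    have "p i j * f j x \<le> col_max p j * f j x"
      using le_col_max[of p i j] f by (intro mult_right_mono) auto
    then show ?thesis using dom[OF that] a by (simp add: mult.commute)
  qed
qed

text \<open>The positions \<open>w \<le> s < s + N + 1 \<le> s + N + 1 + N < M\<close> of the word are the time at which the
  cluster catches all paths, the start of the dominant run, the node, and the end of the run.
  The node divides the run so that \<open>N\<close> steps are available for each direction of the
  contraction. With \<open>q \<le> U\<close> throughout and \<open>q \<ge> \<pi> * \<epsilon>\<close> along linked paths, a detour costs a factor
  of at most \<open>U / (\<pi> * \<epsilon>)\<close> per step.\<close>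

lemma strong_barrier_of_word:
  fixes p :: "'y::finite \<Rightarrow> 'y \<Rightarrow> real" and g :: "nat \<Rightarrow> 'y"
  assumes p1: "\<And>z. 0 \<le> p\<^sub>1 z" and p: "\<And>i j. 0 \<le> p i j" "\<And>i j. p i j \<le> 1"
    and f: "\<And>j x. 0 \<le> f j x" and b: "b \<in> {1..M} \<rightarrow>\<^sub>E UNIV"
    and time: "2 \<le> w" "w \<le> s" "s + N + 1 + N < M"
    and \<pi>: "0 < \<pi>" "\<And>i j. 0 < p i j \<Longrightarrow> \<pi> \<le> p i j"
    and U: "0 < U" "\<And>l j. 1 \<le> l \<Longrightarrow> l \<le> M \<Longrightarrow> f j (b l) \<le> U"
    and \<epsilon>: "0 < \<epsilon>" "\<And>l j. 1 \<le> l \<Longrightarrow> l \<le> M \<Longrightarrow> j \<in> E l \<Longrightarrow> \<epsilon> \<le> f j (b l)"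
    and entry: "\<And>j. 0 < f j (b w) \<Longrightarrow> linked p E w s j (g s)"
    and exit: "\<And>j. 0 < f j (b M) \<Longrightarrow> linked p E (s + N + 1 + N) M (g (s + N + 1 + N)) j"
    and run: "\<And>k. s < k \<Longrightarrow> k \<le> s + N + 1 + N \<Longrightarrow> p (g (k - 1)) (g k) = col_max p (g k)"
    and dom: "\<And>k j. s < k \<Longrightarrow> k \<le> s + N + 1 + N \<Longrightarrow> j \<noteq> g k \<Longrightarrow>
               f j (b k) * col_max p j \<le> \<rho> * (f (g k) (b k) * col_max p (g k))"
    and \<rho>: "0 \<le> \<rho>" "\<rho> < 1"
    and B: "(U / (\<pi> * \<epsilon>)) ^ (s - w) \<le> B" "(U / (\<pi> * \<epsilon>)) ^ (M - (s + N + 1 + N)) \<le> B"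
      "\<rho> ^ N * B \<le> 1"
  shows "strong_barrier p\<^sub>1 (hmm_q p f) (g (s + N + 1)) (M - (s + N + 1)) M b"
  unfolding strong_barrier_def
proof (intro conjI allI impI, rule b)
  fix x m assume "M \<le> m \<and> (\<forall>l\<in>{1..M}. x (m - M + l) = b l)"
  \<comment> \<open>The word sits at the times \<open>off + 1, \<dots>, off + M\<close>; the shift keeps all times absolute below.\<close>
  define off where "off = m - M"
  then have m: "m = off + M" and x: "\<And>l. 1 \<le> l \<Longrightarrow> l \<le> M \<Longrightarrow> x (off + l) = b l"
    using \<open>M \<le> m \<and> _\<close> by auto
  show "M - (s + N + 1) < m" using time m by simp
  let ?q = "hmm_q p f" and ?u = "s + N + 1 + N"
  have q: "0 \<le> ?q z z'" for z z' using p f by (simp add: hmm_q_def split: prod.split)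
  have xk: "x k = b (k - off)" if "off < k" "k \<le> m" for k
    using x[of "k - off"] that m by simp
  have upper: "?q (x (k - 1), i) (x k, j) \<le> U" if "off < k" "k \<le> m" for k i j
  proof -
    have "p i j * f j (x k) \<le> 1 * f j (x k)" using p f by (intro mult_right_mono) auto
    also have "\<dots> \<le> U" using xk[OF that] U(2)[of "k - off" j] that m by simp
    finally show ?thesis by simp
  qed
  have lower: "\<exists>y. y (off + c) = i \<and> y (off + d) = j \<and>
      (\<forall>k. off + c < k \<longrightarrow> k \<le> off + d \<longrightarrow> \<pi> * \<epsilon> \<le> ?q (x (k - 1), y (k - 1)) (x k, y k))"
    if link: "linked p E c d i j" and "d \<le> M" for c d i j
  proof -
    obtain y where y: "y c = i" "y d = j"
      "\<And>k. c < k \<Longrightarrow> k \<le> d \<Longrightarrow> 0 < p (y (k - 1)) (y k) \<and> y k \<in> E k"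
      using link unfolding linked_def by blast
    have "\<pi> * \<epsilon> \<le> ?q (x (k - 1), y (k - 1 - off)) (x k, y (k - off))"
      if k: "off + c < k" "k \<le> off + d" for k
    proof -
      have "\<pi> \<le> p (y (k - off - 1)) (y (k - off))" "y (k - off) \<in> E (k - off)"
        using y(3)[of "k - off"] k \<pi>(2) by auto
      moreover have "\<epsilon> \<le> f (y (k - off)) (b (k - off))"
        using \<epsilon>(2)[OF _ _ calculation(2)] k \<open>d \<le> M\<close> by simp
      moreover have "k - off - 1 = k - 1 - off" by simp
      ultimately show ?thesis using xk[of k] k \<open>d \<le> M\<close> m \<pi>(1) \<epsilon>(1) p
        by (simp add: mult_mono)
    qed
    then show ?thesis using y by (intro exI[of _ "\<lambda>k. y (k - off)"]) auto
  qed
  have \<kappa>: "0 < \<pi> * \<epsilon>" using \<pi> \<epsilon> by simp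
  have B0: "0 \<le> B" using B(1) U \<kappa> by (meson divide_nonneg_pos less_imp_le order_trans zero_le_power)
  have node: "strong_node p\<^sub>1 ?q x m (off + s + N + 1) (g (off + s + N + 1 - off))"
  proof (rule strong_node_of_dominant_run[where a = "\<lambda>k. g (k - off)" and n' = N, OF p1 q _ _ B0 \<rho>])
    show "1 \<le> off + s" "off + s + N + 1 + N < m" using time m by auto
    show "dominant_step \<rho> (\<lambda>i j. ?q (x (k - 1), i) (x k, j)) (g (k - 1 - off)) (g (k - off))"
      if k: "off + s < k" "k \<le> off + s + N + 1 + N" for k
    proof (rule dominant_step_hmm[OF f])
      show "p (g (k - 1 - off)) (g (k - off)) = col_max p (g (k - off))"
        using run[of "k - off"] k by (simp add: diff_commute)
      show "f j (x k) * col_max p j \<le> \<rho> * (f (g (k - off)) (x k) * col_max p (g (k - off)))"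
        if "j \<noteq> g (k - off)" for j
        using dom[of "k - off" j] that k xk[of k] time m by simp
    qed
    show "\<rho> ^ N * B \<le> 1" "\<rho> ^ N * B \<le> 1" by (rule B(3))+
    show "viterbi_score p\<^sub>1 ?q x (off + s) i \<le> B * viterbi_score p\<^sub>1 ?q x (off + s) (g (off + s - off))" for i
    proof -
      have "viterbi_score p\<^sub>1 ?q x (off + s) i
          \<le> (U / (\<pi> * \<epsilon>)) ^ (off + s - (off + w)) * viterbi_score p\<^sub>1 ?q x (off + s) (g s)"
      proof (rule viterbi_score_entry[OF p1 q _ _ \<kappa> U(1)])
        show "2 \<le> off + w" "off + w \<le> off + s" using time by auto
        show "?q (x (k - 1), i) (x k, j) \<le> U" if "off + w < k" "k \<le> off + s" for k i j
          using that time m by (intro upper) auto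
        fix j z assume "0 < ?q z (x (off + w), j)"
        then have "0 < f j (x (off + w))" using f p
          by (auto simp: hmm_q_def zero_less_mult_iff less_le split: prod.splits)
        then have "linked p E w s j (g s)" using entry x[of w] time by simp
        then show "\<exists>y. y (off + w) = j \<and> y (off + s) = g s \<and> (\<forall>k. off + w < k \<longrightarrow> k \<le> off + s \<longrightarrow>
            \<pi> * \<epsilon> \<le> ?q (x (k - 1), y (k - 1)) (x k, y k))"
          using time by (intro lower) auto
      qed
      also have "\<dots> \<le> B * viterbi_score p\<^sub>1 ?q x (off + s) (g s)"
        using B viterbi_score_nonneg[of p\<^sub>1 ?q, OF p1 q] time by (intro mult_right_mono) auto
      finally show ?thesis by simp
    qed
    show "path_max ?q x (off + s + N + 1 + N) m i j
        \<le> B * path_max ?q x (off + s + N + 1 + N) m (g (off + s + N + 1 + N - off)) j" for i j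
    proof -
      have "path_max ?q x (off + ?u) m i j
          \<le> (U / (\<pi> * \<epsilon>)) ^ (m - (off + ?u)) * path_max ?q x (off + ?u) m (g ?u) j"
      proof (rule path_max_exit[OF q _ \<kappa> U(1)])
        show "off + ?u < m" using time m by simp
        show "?q (x (k - 1), i) (x k, j) \<le> U" if "off + ?u < k" "k \<le> m" for k i j
          using that by (intro upper) auto
        fix z assume "0 < ?q z (x m, j)"
        then have "0 < f j (x m)" using f p
          by (auto simp: hmm_q_def zero_less_mult_iff less_le split: prod.splits)
        then have "linked p E ?u M (g ?u) j" using exit x[of M] time m by simp
        then show "\<exists>y. y (off + ?u) = g ?u \<and> y m = j \<and> (\<forall>k. off + ?u < k \<longrightarrow> k \<le> m \<longrightarrow>
            \<pi> * \<epsilon> \<le> ?q (x (k - 1), y (k - 1)) (x k, y k))"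
          unfolding m by (intro lower) auto
      qed
      also have "\<dots> \<le> B * path_max ?q x (off + ?u) m (g ?u) j"
        using B(2) path_max_nonneg[of ?q, OF q] time m
        by (intro mult_right_mono) (auto simp: add.assoc)
      finally show ?thesis by (simp add: add.assoc)
    qed
  qed
  have "off + s + N + 1 - off = s + N + 1" "m - (M - (s + N + 1)) = off + s + N + 1"
    using m time by simp_all
  then show "strong_node p\<^sub>1 ?q x m (m - (M - (s + N + 1))) (g (s + N + 1))"
    using node by metis
qed

section \<open>Probabilities of finite patterns\<close>

definition emission_mass :: "'x measure \<Rightarrow> ('y \<Rightarrow> 'x \<Rightarrow> real) \<Rightarrow> 'y \<Rightarrow> 'x set \<Rightarrow> ennreal" where
  "emission_mass \<mu> f j B = (\<integral>\<^sup>+x\<in>B. ennreal (f j x) \<partial>\<mu>)"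

locale hidden_markov =
  fixes P :: "'w measure"
    and X :: "nat \<Rightarrow> 'w \<Rightarrow> 'x::{metric_space, second_countable_topology}"
    and Y :: "nat \<Rightarrow> 'w \<Rightarrow> 'y::finite"
    and \<mu> \<nu> :: "'x measure"
    and p :: "'y \<Rightarrow> 'y \<Rightarrow> real"
    and f :: "'y \<Rightarrow> 'x \<Rightarrow> real"
    and p\<^sub>1 :: "'x \<times> 'y \<Rightarrow> real"
  assumes hmm: "hidden_markov_model P X Y \<mu> p f \<nu> p\<^sub>1"
begin

abbreviation "NZ \<equiv> (borel :: 'x measure) \<Otimes>\<^sub>M (count_space UNIV :: 'y measure)"
abbreviation "Z \<equiv> \<lambda>k \<omega>. (X k \<omega>, Y k \<omega>)"
abbreviation "past k \<equiv> past_algebra P NZ Z k"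
abbreviation "hmm_kernel \<equiv> \<lambda>z'. density (\<mu> \<Otimes>\<^sub>M count_space UNIV) (\<lambda>z. ennreal (hmm_q p f z' z))"

lemma prob_space_P: "prob_space P"
  and sets_mu: "sets \<mu> = sets borel"
  and p_nonneg: "0 \<le> p i j"
  and p_row_sum: "(\<Sum>j\<in>UNIV. p i j) = 1"
  and f_measurable [measurable]: "f j \<in> borel_measurable borel"
  and f_nonneg: "0 \<le> f j x"
  and f_total: "(\<integral>\<^sup>+x. ennreal (f j x) \<partial>\<mu>) = 1"
  and p1_nonneg: "0 \<le> p\<^sub>1 z"
  and chain: "homogeneous_markov_chain P NZ hmm_kernel Z"
  using hmm unfolding hidden_markov_model_def stochastic_matrix_def by blast+

sublocale prob_space P by (rule prob_space_P)

lemma p_le_1: "p i j \<le> 1"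
  using member_le_sum[of j UNIV "p i"] p_nonneg p_row_sum by simp

lemma Z_measurable: "1 \<le> k \<Longrightarrow> Z k \<in> P \<rightarrow>\<^sub>M NZ"
  using chain by (simp add: homogeneous_markov_chain_def)

lemma tuple_measurable: "(\<lambda>\<omega>. \<lambda>l\<in>{1..k}. Z l \<omega>) \<in> P \<rightarrow>\<^sub>M (\<Pi>\<^sub>M l\<in>{1..k}. NZ)"
  by (intro measurable_restrict Z_measurable) auto

lemma space_past [simp]: "space (past k) = space P"
  by (simp add: past_algebra_def)

lemma sets_past:
  "sets (past k) = {(\<lambda>\<omega>. \<lambda>l\<in>{1..k}. Z l \<omega>) -` A \<inter> space P | A. A \<in> sets (\<Pi>\<^sub>M l\<in>{1..k}. NZ)}"
  unfolding past_algebra_def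
  using tuple_measurable[of k] by (intro sets_vimage_algebra2) (auto simp: measurable_def)

lemma subalgebra_past: "subalgebra P (past k)"
  unfolding subalgebra_def using tuple_measurable[of k]
  by (auto simp: sets_past intro: measurable_sets)

lemma past_subset_events: "A \<in> sets (past k) \<Longrightarrow> A \<in> events"
  using subalgebra_past unfolding subalgebra_def by blast

lemma Z_past_measurable:
  assumes "1 \<le> l" "l \<le> k"
  shows "Z l \<in> past k \<rightarrow>\<^sub>M NZ"
proof -
  have "(\<lambda>\<omega>. \<lambda>l\<in>{1..k}. Z l \<omega>) \<in> past k \<rightarrow>\<^sub>M (\<Pi>\<^sub>M l\<in>{1..k}. NZ)"
    unfolding past_algebra_def
    using tuple_measurable[of k] by (intro measurable_vimage_algebra1) (auto simp: measurable_def)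
  then have "(\<lambda>\<omega>. (\<lambda>l\<in>{1..k}. Z l \<omega>) l) \<in> past k \<rightarrow>\<^sub>M NZ"
    by (rule measurable_compose[OF _ measurable_component_singleton]) (use assms in simp)
  then show ?thesis using assms by simp
qed

lemma past_mono: "k \<le> l \<Longrightarrow> sets (past k) \<subseteq> sets (past l)"
proof -
  assume kl: "k \<le> l"
  have "(\<lambda>\<omega>. \<lambda>l\<in>{1..k}. Z l \<omega>) \<in> past l \<rightarrow>\<^sub>M (\<Pi>\<^sub>M l\<in>{1..k}. NZ)"
    using kl by (intro measurable_restrict Z_past_measurable) auto
  then show ?thesis
    unfolding sets_past[of k] by (auto dest: measurable_sets)
qed

lemma X_past_measurable: "1 \<le> l \<Longrightarrow> l \<le> k \<Longrightarrow> X l \<in> past k \<rightarrow>\<^sub>M borel"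
  using measurable_compose[OF Z_past_measurable measurable_fst] by simp

lemma Y_past_measurable: "1 \<le> l \<Longrightarrow> l \<le> k \<Longrightarrow> Y l \<in> past k \<rightarrow>\<^sub>M count_space UNIV"
  using measurable_compose[OF Z_past_measurable measurable_snd] by simp

lemma past_event_Z:
  assumes "1 \<le> l" "l \<le> k" "B \<in> sets borel"
  shows "{\<omega> \<in> space P. X l \<omega> \<in> B \<and> Y l \<omega> = j} \<in> sets (past k)"
proof -
  have [measurable]: "X l \<in> past k \<rightarrow>\<^sub>M borel" "Y l \<in> past k \<rightarrow>\<^sub>M count_space UNIV"
    using X_past_measurable Y_past_measurable assms by blast+
  note assms(3)[measurable]
  have "{\<omega> \<in> space (past k). X l \<omega> \<in> B \<and> Y l \<omega> = j} \<in> sets (past k)" by measurable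
  then show ?thesis by simp
qed

lemma emission_mass_le_1: "emission_mass \<mu> f j B \<le> 1"
  unfolding emission_mass_def f_total[of j, symmetric]
  by (intro nn_integral_mono) (auto simp: indicator_def)

lemma hmm_q_measurable: "(\<lambda>z. ennreal (hmm_q p f z' z)) \<in> borel_measurable (\<mu> \<Otimes>\<^sub>M count_space UNIV)"
proof -
  have [measurable_cong]: "sets \<mu> = sets borel" by (rule sets_mu)
  have "(\<lambda>z. ennreal (hmm_q p f z' z)) =
      (\<lambda>z. \<Sum>j\<in>UNIV. ennreal (p (snd z') j * f j (fst z)) * indicator {j} (snd z))"
    by (auto simp: hmm_q_def fun_eq_iff indicator_def sum.If_cases split: prod.splits)
  also have "\<dots> \<in> borel_measurable (\<mu> \<Otimes>\<^sub>M count_space UNIV)" by measurable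
  finally show ?thesis .
qed

lemma kernel_rectangle:
  assumes "B \<in> sets borel"
  shows "emeasure (hmm_kernel z') (B \<times> {j}) = ennreal (p (snd z') j) * emission_mass \<mu> f j B"
proof -
  interpret cs: sigma_finite_measure "count_space (UNIV :: 'y set)"
    by (rule sigma_finite_measure_count_space_finite) simp
  have [measurable_cong]: "sets \<mu> = sets borel" by (rule sets_mu)
  have BB: "B \<times> {j} \<in> sets (\<mu> \<Otimes>\<^sub>M count_space UNIV)" using assms sets_mu by auto
  have "emeasure (hmm_kernel z') (B \<times> {j})
      = (\<integral>\<^sup>+z. ennreal (hmm_q p f z' z) * indicator (B \<times> {j}) z \<partial>(\<mu> \<Otimes>\<^sub>M count_space UNIV))"
    using BB hmm_q_measurable by (intro emeasure_density)
  also have "\<dots> = (\<integral>\<^sup>+x. \<integral>\<^sup>+i. ennreal (hmm_q p f z' (x, i)) * indicator (B \<times> {j}) (x, i)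
                      \<partial>count_space UNIV \<partial>\<mu>)"
    using BB hmm_q_measurable by (intro cs.nn_integral_fst[symmetric] borel_measurable_times_ennreal) auto
  also have "\<dots> = (\<integral>\<^sup>+x. ennreal (p (snd z') j) * (ennreal (f j x) * indicator B x) \<partial>\<mu>)"
  proof (intro nn_integral_cong)
    fix x
    have "(\<integral>\<^sup>+i. ennreal (hmm_q p f z' (x, i)) * indicator (B \<times> {j}) (x, i) \<partial>count_space UNIV)
        = (\<Sum>i\<in>UNIV. ennreal (hmm_q p f z' (x, i)) * indicator (B \<times> {j}) (x, i))"
      by (intro nn_integral_count_space_finite) simp
    also have "\<dots> = (\<Sum>i\<in>UNIV. if i = j then ennreal (hmm_q p f z' (x, j)) * indicator B x else 0)"
      by (intro sum.cong) (auto simp: indicator_def)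
    also have "\<dots> = ennreal (p (snd z') j) * (ennreal (f j x) * indicator B x)"
      by (simp add: hmm_q_def case_prod_beta ennreal_mult' p_nonneg mult.assoc)
    finally show "(\<integral>\<^sup>+i. ennreal (hmm_q p f z' (x, i)) * indicator (B \<times> {j}) (x, i) \<partial>count_space UNIV)
        = ennreal (p (snd z') j) * (ennreal (f j x) * indicator B x)" .
  qed
  also have "\<dots> = ennreal (p (snd z') j) * emission_mass \<mu> f j B"
    unfolding emission_mass_def using assms sets_mu
    by (intro nn_integral_cmult borel_measurable_times_ennreal measurable_compose[OF _ measurable_ennreal]
        borel_measurable_indicator) auto
  finally show ?thesis .
qed

text \<open>The kernel depends on the past only through the hidden state. Once that state is fixed on
  \<open>F\<close>, the conditional probability is a constant, and no integral over the past remains.\<close>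

lemma prob_one_step:
  assumes k: "1 \<le> k" and F: "F \<in> sets (past k)" and Y: "\<And>\<omega>. \<omega> \<in> F \<Longrightarrow> Y k \<omega> = i"
    and B: "B \<in> sets borel"
  shows "prob (F \<inter> {\<omega> \<in> space P. X (Suc k) \<omega> \<in> B \<and> Y (Suc k) \<omega> = j})
           = prob F * (p i j * enn2real (emission_mass \<mu> f j B))"
proof -
  interpret fs: finite_measure_subalgebra P "past k"
    by unfold_locales (rule subalgebra_past)
  let ?A = "B \<times> {j}"
  let ?h = "\<lambda>\<omega>. indicator ?A (Z (Suc k) \<omega>) :: real"
  let ?E = "{\<omega> \<in> space P. X (Suc k) \<omega> \<in> B \<and> Y (Suc k) \<omega> = j}"
  have A: "?A \<in> sets NZ" using B by auto
  have E: "?E \<in> events" 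
    by (rule past_subset_events[OF past_event_Z[OF _ order_refl B]]) simp
  have F': "F \<in> events" by (rule past_subset_events[OF F])
  have "integrable P (indicator ?E :: _ \<Rightarrow> real)"
    using E by (intro integrable_real_indicator) (simp_all add: less_top[symmetric])
  then have int: "integrable P ?h"
    by (rule Bochner_Integration.integrable_cong[THEN iffD1, rotated 2]) (auto simp: indicator_def)
  have "prob (F \<inter> ?E) = (\<integral>\<omega>\<in>F. ?h \<omega> \<partial>P)"
  proof -
    have "(\<integral>\<omega>\<in>F. ?h \<omega> \<partial>P) = (\<integral>\<omega>. indicator (F \<inter> ?E) \<omega> \<partial>P)"
      unfolding set_lebesgue_integral_def by (intro Bochner_Integration.integral_cong) (auto simp: indicator_def)
    then show ?thesis using E F' by simp
  qed
  also have "\<dots> = (\<integral>\<omega>\<in>F. real_cond_exp P (past k) ?h \<omega> \<partial>P)"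
    by (rule fs.real_cond_exp_intA[OF int F])
  also have "\<dots> = (\<integral>\<omega>. indicator F \<omega> * (p i j * enn2real (emission_mass \<mu> f j B)) \<partial>P)"
    unfolding set_lebesgue_integral_def
  proof (rule integral_cong_AE)
    have "AE \<omega> in P. real_cond_exp P (past k) ?h \<omega> = measure (hmm_kernel (Z k \<omega>)) ?A"
      using chain k A by (auto simp: homogeneous_markov_chain_def)
    then show "AE \<omega> in P. indicator F \<omega> *\<^sub>R real_cond_exp P (past k) ?h \<omega>
        = indicator F \<omega> * (p i j * enn2real (emission_mass \<mu> f j B))"
    proof eventually_elim
      case (elim \<omega>)
      show ?case
      proof (cases "\<omega> \<in> F")
        case True
        then show ?thesis
          using elim Y[OF True] kernel_rectangle[OF B, of "Z k \<omega>" j] p_nonneg[of i j]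
          by (simp add: measure_def enn2real_mult)
      qed simp
    qed
  qed (use F' fs.subalg in \<open>auto intro!: borel_measurable_scaleR borel_measurable_times simp: borel_measurable_cond_exp2\<close>)
  also have "\<dots> = prob F * (p i j * enn2real (emission_mass \<mu> f j B))"
    using F' by simp
  finally show ?thesis .
qed

definition pattern :: "nat \<Rightarrow> nat \<Rightarrow> (nat \<Rightarrow> 'x set) \<Rightarrow> (nat \<Rightarrow> 'y) \<Rightarrow> 'w set" where
  "pattern k n B g = {\<omega> \<in> space P. \<forall>l\<in>{1..n}. X (k + l) \<omega> \<in> B l \<and> Y (k + l) \<omega> = g l}"

text \<open>Iterating the one-step formula works because the event stays in the past algebra and again
  fixes the current hidden state.\<close>

lemma prob_pattern:
  assumes k: "1 \<le> k" and F: "F \<in> sets (past k)" and Y: "\<And>\<omega>. \<omega> \<in> F \<Longrightarrow> Y k \<omega> = g 0"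
    and B: "\<And>l. l \<in> {1..n} \<Longrightarrow> B l \<in> sets borel"
  shows "F \<inter> pattern k n B g \<in> sets (past (k + n)) \<and>
         prob (F \<inter> pattern k n B g)
           = prob F * (\<Prod>l\<in>{1..n}. p (g (l - 1)) (g l) * enn2real (emission_mass \<mu> f (g l) (B l)))"
  using B
proof (induction n)
  case 0
  have "F \<inter> space P = F" using F sets.sets_into_space by fastforce
  then show ?case using F by (simp add: pattern_def)
next
  case (Suc n)
  let ?F = "F \<inter> pattern k n B g"
  let ?E = "{\<omega> \<in> space P. X (Suc (k + n)) \<omega> \<in> B (Suc n) \<and> Y (Suc (k + n)) \<omega> = g (Suc n)}"
  have eq: "F \<inter> pattern k (Suc n) B g = ?F \<inter> ?E"
    by (auto simp: pattern_def atLeastAtMostSuc_conv)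
  have IH: "?F \<in> sets (past (k + n))" 
    "prob ?F = prob F * (\<Prod>l\<in>{1..n}. p (g (l - 1)) (g l) * enn2real (emission_mass \<mu> f (g l) (B l)))"
    using Suc by auto
  have Yn: "Y (k + n) \<omega> = g n" if "\<omega> \<in> ?F" for \<omega>
  proof (cases "n = 0")
    case False
    then have "n \<in> {1..n}" by simp
    then show ?thesis using that unfolding pattern_def by blast
  qed (use that Y in auto)
  have "prob (?F \<inter> ?E) = prob ?F * (p (g n) (g (Suc n)) * enn2real (emission_mass \<mu> f (g (Suc n)) (B (Suc n))))"
    by (rule prob_one_step[OF _ IH(1) Yn]) (use k Suc.prems in simp_all)
  moreover have "?F \<inter> ?E \<in> sets (past (k + Suc n))"
  proof (rule sets.Int)
    show "?F \<in> sets (past (k + Suc n))"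
      by (rule subsetD[OF past_mono IH(1)]) simp
    show "?E \<in> sets (past (k + Suc n))"
      by (rule past_event_Z) (use Suc.prems in simp_all)
  qed
  ultimately show ?case unfolding eq using IH(2) by simp
qed


section \<open>Recurrence of patterns\<close>

definition occurrence :: "nat \<Rightarrow> (nat \<Rightarrow> 'x set) \<Rightarrow> nat \<Rightarrow> 'w set" where
  "occurrence M B l = {\<omega> \<in> space P. \<forall>n\<in>{1..M}. X (l + n - 1) \<omega> \<in> B n}"

lemma occurrence_past:
  assumes B: "\<And>l. 1 \<le> l \<Longrightarrow> l \<le> M \<Longrightarrow> B l \<in> sets borel" and l: "1 \<le> l" "l + M \<le> k + 1"
  shows "occurrence M B l \<in> sets (past k)"
proof -
  have "{\<omega> \<in> space (past k). \<forall>n\<in>{1..M}. X (l + n - 1) \<omega> \<in> B n} \<in> sets (past k)"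
  proof (intro sets.sets_Collect_finite_All)
    fix n assume n: "n \<in> {1..M}"
    have "X (l + n - 1) \<in> past k \<rightarrow>\<^sub>M borel" using n l by (intro X_past_measurable) auto
    from measurable_sets[OF this B[of n]] n
    show "{\<omega> \<in> space (past k). X (l + n - 1) \<omega> \<in> B n} \<in> sets (past k)"
      by (simp add: vimage_def Int_def conj_commute)
  qed simp
  then show ?thesis by (simp add: occurrence_def)
qed

lemma occurrence_events:
  assumes "\<And>l. 1 \<le> l \<Longrightarrow> l \<le> M \<Longrightarrow> B l \<in> sets borel" "1 \<le> l"
  shows "occurrence M B l \<in> events"
  by (rule past_subset_events[OF occurrence_past[of M B l "l + M"]]) (use assms in auto)

lemma emission_mass_pos:
  assumes "A \<in> sets borel" "0 < emeasure \<mu> A" "\<And>x. x \<in> A \<Longrightarrow> 0 < f j x"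
  shows "0 < enn2real (emission_mass \<mu> f j A)"
proof -
  have [measurable_cong]: "sets \<mu> = sets borel" by (rule sets_mu)
  have meas: "(\<lambda>x. ennreal (f j x) * indicator A x) \<in> borel_measurable \<mu>"
    using assms(1) by measurable
  have "emission_mass \<mu> f j A \<noteq> 0"
  proof
    assume "emission_mass \<mu> f j A = 0"
    then have "AE x in \<mu>. ennreal (f j x) * indicator A x = 0"
      unfolding emission_mass_def using nn_integral_0_iff_AE[OF meas] by simp
    then have "AE x in \<mu>. x \<notin> A"
      by eventually_elim (use assms(3) in \<open>fastforce simp: indicator_def split: if_splits\<close>)
    then have "emeasure \<mu> A = 0"
      using assms(1) sets_mu by (subst (asm) AE_iff_null) (auto simp: null_sets_def space_def[symmetric] sets_eq_imp_space_eq[OF sets_mu])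
    then show False using assms(2) by simp
  qed
  moreover have "emission_mass \<mu> f j A < \<infinity>"
    using emission_mass_le_1[of j A] by (auto simp: less_top[symmetric] top_unique)
  ultimately show ?thesis by (simp add: enn2real_positive_iff zero_less_iff_neq_zero)
qed

text \<open>The state path first travels from \<open>i\<close> to the start of the pattern with unconstrained
  observations and then emits the pattern. The last state of the approach is the first state of
  the pattern, which accounts for the index shift \<open>l + 1 - n\<close>.\<close>

lemma occurrence_from_state:
  assumes M: "1 \<le> M" and link: "linked p (\<lambda>_. UNIV) 0 n i (g 1)" "1 \<le> n"
    and B: "\<And>l. 1 \<le> l \<Longrightarrow> l \<le> M \<Longrightarrow> B l \<in> sets borel"
    and g: "\<And>l. 1 < l \<Longrightarrow> l \<le> M \<Longrightarrow> 0 < p (g (l - 1)) (g l)"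
    and mass: "\<And>l. 1 \<le> l \<Longrightarrow> l \<le> M \<Longrightarrow> 0 < enn2real (emission_mass \<mu> f (g l) (B l))"
  shows "\<exists>w>0. \<forall>k F. 1 \<le> k \<longrightarrow> F \<in> sets (past k) \<longrightarrow> (\<forall>\<omega>\<in>F. Y k \<omega> = i) \<longrightarrow>
           w * prob F \<le> prob (F \<inter> occurrence M B (k + n))"
proof -
  obtain y where y: "y 0 = i" "y n = g 1" "\<And>k. 0 < k \<Longrightarrow> k \<le> n \<Longrightarrow> 0 < p (y (k - 1)) (y k)"
    using link(1) unfolding linked_def by blast
  define h where "h = (\<lambda>l. if l \<le> n then y l else g (l + 1 - n))"
  define A where "A = (\<lambda>l. if l < n then UNIV else B (l + 1 - n))"
  define N where "N = n + M - 1"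
  have h: "h l = g (l + 1 - n)" if "n \<le> l" for l using that y by (auto simp: h_def)
  define w where "w = (\<Prod>l\<in>{1..N}. p (h (l - 1)) (h l) * enn2real (emission_mass \<mu> f (h l) (A l)))"
  have "0 < w"
    unfolding w_def
  proof (intro prod_pos mult_pos_pos ballI)
    fix l assume l: "l \<in> {1..N}"
    show "0 < p (h (l - 1)) (h l)"
    proof (cases "l \<le> n")
      case True
      then have "l - 1 \<le> n" by simp
      then show ?thesis using y(3)[of l] True l by (simp add: h_def)
    next
      case False
      then have "l - 1 + 1 - n = l + 1 - n - 1" by simp
      then show ?thesis using g[of "l + 1 - n"] h[of l] h[of "l - 1"] l False by (simp add: N_def)
    qed
    show "0 < enn2real (emission_mass \<mu> f (h l) (A l))"
    proof (cases "l < n")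
      case True
      then show ?thesis using f_total by (simp add: A_def emission_mass_def)
    next
      case False
      then have "1 \<le> l + 1 - n" "l + 1 - n \<le> M" using l M by (auto simp: N_def)
      from mass[OF this] show ?thesis using False h[of l] by (simp add: A_def)
    qed
  qed
  moreover have "w * prob F \<le> prob (F \<inter> occurrence M B (k + n))"
    if k: "1 \<le> k" and F: "F \<in> sets (past k)" and Y: "\<forall>\<omega>\<in>F. Y k \<omega> = i" for k F
  proof -
    have A: "A l \<in> sets borel" if "l \<in> {1..N}" for l
      using B[of "l + 1 - n"] that by (auto simp: A_def N_def)
    have "Y k \<omega> = h 0" if "\<omega> \<in> F" for \<omega> using Y y that by (simp add: h_def)
    from prob_pattern[where g = h and B = A and n = N, OF k F this A]
    have "w * prob F = prob (F \<inter> pattern k N A h)" by (simp add: w_def mult.commute)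
    also have "\<dots> \<le> prob (F \<inter> occurrence M B (k + n))"
    proof (intro finite_measure_mono)
      have "X (k + n + j - 1) \<omega> \<in> B j" if "j \<in> {1..M}" "\<omega> \<in> pattern k N A h" for j \<omega>
      proof -
        have "n + j - 1 \<in> {1..N}" "A (n + j - 1) = B j" "k + (n + j - 1) = k + n + j - 1"
          using that(1) link(2) by (auto simp: N_def A_def)
        then show ?thesis using that(2) unfolding pattern_def by fastforce
      qed
      then show "F \<inter> pattern k N A h \<subseteq> F \<inter> occurrence M B (k + n)"
        unfolding occurrence_def by (auto simp: pattern_def)
      show "F \<inter> occurrence M B (k + n) \<in> events"
        using past_subset_events[OF F] occurrence_events[of M B "k + n"] B k by auto
    qed
    finally show ?thesis .
  qed
  ultimately show ?thesis by blast
qed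

text \<open>Splitting \<open>F\<close> according to the hidden state at time \<open>k\<close> reduces this to the previous lemma; as
  there are finitely many states, the probabilities have a common positive lower bound.\<close>

lemma occurrence_uniform:
  assumes irr: "irreducible_matrix p" and M: "1 \<le> M"
    and B: "\<And>l. 1 \<le> l \<Longrightarrow> l \<le> M \<Longrightarrow> B l \<in> sets borel"
    and g: "\<And>l. 1 < l \<Longrightarrow> l \<le> M \<Longrightarrow> 0 < p (g (l - 1)) (g l)"
    and mass: "\<And>l. 1 \<le> l \<Longrightarrow> l \<le> M \<Longrightarrow> 0 < enn2real (emission_mass \<mu> f (g l) (B l))"
  shows "\<exists>D. \<exists>w>0. \<forall>k F. 1 \<le> k \<longrightarrow> F \<in> sets (past k) \<longrightarrow>
           w * prob F \<le> prob (F \<inter> (\<Union>l\<in>{k+1..k+D}. occurrence M B l))"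
proof -
  obtain D where D: "\<And>i j. \<exists>n. 1 \<le> n \<and> n \<le> D \<and> linked p (\<lambda>_. UNIV) 0 n i j"
    using irreducible_linked[OF p_nonneg irr] by blast
  have "\<forall>i. \<exists>n. 1 \<le> n \<and> n \<le> D \<and> linked p (\<lambda>_. UNIV) 0 n i (g 1)" using D by blast
  from choice[OF this] obtain n
    where n: "\<And>i. 1 \<le> n i \<and> n i \<le> D \<and> linked p (\<lambda>_. UNIV) 0 (n i) i (g 1)" by blast
  have "\<forall>i. \<exists>w>0. \<forall>k F. 1 \<le> k \<longrightarrow> F \<in> sets (past k) \<longrightarrow> (\<forall>\<omega>\<in>F. Y k \<omega> = i) \<longrightarrow>
      w * prob F \<le> prob (F \<inter> occurrence M B (k + n i))"
  proof
    fix i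
    have ni: "linked p (\<lambda>_. UNIV) 0 (n i) i (g 1)" "1 \<le> n i" using n by auto
    show "\<exists>w>0. \<forall>k F. 1 \<le> k \<longrightarrow> F \<in> sets (past k) \<longrightarrow> (\<forall>\<omega>\<in>F. Y k \<omega> = i) \<longrightarrow>
        w * prob F \<le> prob (F \<inter> occurrence M B (k + n i))"
      by (rule occurrence_from_state[OF M, where n = "n i" and i = i and g = g]) (fact ni B g mass)+
  qed
  from choice[OF this] obtain w where "\<forall>i. 0 < w i \<and> (\<forall>k F. 1 \<le> k \<longrightarrow> F \<in> sets (past k) \<longrightarrow>
      (\<forall>\<omega>\<in>F. Y k \<omega> = i) \<longrightarrow> w i * prob F \<le> prob (F \<inter> occurrence M B (k + n i)))" ..
  then have w: "\<And>i. 0 < w i" "\<And>i k F. 1 \<le> k \<Longrightarrow> F \<in> sets (past k) \<Longrightarrow> (\<forall>\<omega>\<in>F. Y k \<omega> = i) \<Longrightarrow>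
      w i * prob F \<le> prob (F \<inter> occurrence M B (k + n i))" by blast+
  define w' where "w' = Min (range w)"
  have w': "0 < w'" "w' \<le> w i" for i using w(1) by (auto simp: w'_def)
  have "w' * prob F \<le> prob (F \<inter> (\<Union>l\<in>{k+1..k+D}. occurrence M B l))"
    if k: "1 \<le> k" and F: "F \<in> sets (past k)" for k F
  proof -
    let ?U = "\<Union>l\<in>{k+1..k+D}. occurrence M B l"
    let ?F = "\<lambda>i. F \<inter> {\<omega> \<in> space P. Y k \<omega> = i}"
    have U: "?U \<in> events"
      using B by (intro sets.finite_UN occurrence_events) auto
    have Fi: "?F i \<in> sets (past k)" for i
      using F past_event_Z[of k k UNIV i] k by auto
    have decomp: "prob (G \<inter> F) = (\<Sum>i\<in>UNIV. prob (G \<inter> ?F i))" if "G \<in> events" for G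
    proof -
      have "G \<inter> F = (\<Union>i. G \<inter> ?F i)" using sets.sets_into_space[OF past_subset_events[OF F]] by auto
      also have "prob \<dots> = (\<Sum>i\<in>UNIV. prob (G \<inter> ?F i))"
        using that past_subset_events[OF Fi]
        by (intro finite_measure_finite_Union) (auto simp: disjoint_family_on_def)
      finally show ?thesis .
    qed
    have "F \<subseteq> space P" using sets.sets_into_space[OF past_subset_events[OF F]] .
    then have "w' * prob F = (\<Sum>i\<in>UNIV. w' * prob (?F i))"
      using decomp[of "space P"] by (simp add: sum_distrib_left Int_absorb1 Int_left_absorb Int_left_commute[of "space P" F])
    also have "\<dots> \<le> (\<Sum>i\<in>UNIV. prob (?U \<inter> ?F i))"
    proof (intro sum_mono)
      fix i
      have "w' * prob (?F i) \<le> w i * prob (?F i)" using w'(2) by (intro mult_right_mono) auto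
      also have "\<dots> \<le> prob (?F i \<inter> occurrence M B (k + n i))" by (rule w(2)[OF k Fi]) simp
      also have "\<dots> \<le> prob (?U \<inter> ?F i)"
      proof (rule finite_measure_mono)
        show "?U \<inter> ?F i \<in> events" by (rule sets.Int[OF U past_subset_events[OF Fi]])
        have "k + n i \<in> {k+1..k+D}" using n[of i] by simp
        then show "?F i \<inter> occurrence M B (k + n i) \<subseteq> ?U \<inter> ?F i" by blast
      qed
      finally show "w' * prob (?F i) \<le> prob (?U \<inter> ?F i)" .
    qed
    also have "\<dots> = prob (F \<inter> ?U)" using decomp[OF U] by (simp add: Int_commute)
    finally show ?thesis .
  qed
  then show ?thesis using w'(1) by blast
qed

text \<open>Time is cut into blocks of length \<open>D + M\<close>, long enough for a pattern to start within \<open>D\<close> steps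
  and to be completed inside the block. Avoiding the pattern during a block, given that it was
  avoided before, has probability at most \<open>1 - w\<close>.\<close>

lemma pattern_eventually_occurs:
  assumes irr: "irreducible_matrix p" and M: "1 \<le> M"
    and B: "\<And>l. 1 \<le> l \<Longrightarrow> l \<le> M \<Longrightarrow> B l \<in> sets borel"
    and g: "\<And>l. 1 < l \<Longrightarrow> l \<le> M \<Longrightarrow> 0 < p (g (l - 1)) (g l)"
    and mass: "\<And>l. 1 \<le> l \<Longrightarrow> l \<le> M \<Longrightarrow> 0 < enn2real (emission_mass \<mu> f (g l) (B l))"
    and k: "1 \<le> k"
  shows "AE \<omega> in P. \<exists>l>k. \<omega> \<in> occurrence M B l"
proof -
  have "\<exists>D. \<exists>w>0. \<forall>k F. 1 \<le> k \<longrightarrow> F \<in> sets (past k) \<longrightarrow>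
      w * prob F \<le> prob (F \<inter> (\<Union>l\<in>{k+1..k+D}. occurrence M B l))"
    by (rule occurrence_uniform[OF irr M, of B g]) (fact B g mass)+
  then obtain D w where w: "0 < w" and uniform: "\<And>k F. 1 \<le> k \<Longrightarrow> F \<in> sets (past k) \<Longrightarrow>
      w * prob F \<le> prob (F \<inter> (\<Union>l\<in>{k+1..k+D}. occurrence M B l))"
    by blast
  define T where "T = (\<lambda>n. k + n * (D + M))"
  \<comment> \<open>\<open>H n\<close>: no occurrence that starts after \<open>k\<close> has been completed by time \<open>T n\<close>.\<close>
  define H where "H = (\<lambda>n. space P - (\<Union>l\<in>{l. k < l \<and> l + M \<le> T n + 1}. occurrence M B l))"
  have H: "H n \<in> sets (past (T n))" for n
  proof -
    have "finite {l. k < l \<and> l + M \<le> T n + 1}" by (rule finite_subset[of _ "{..T n + 1}"]) auto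
    then have "(\<Union>l\<in>{l. k < l \<and> l + M \<le> T n + 1}. occurrence M B l) \<in> sets (past (T n))"
      using B by (intro sets.finite_UN occurrence_past) auto
    then show ?thesis unfolding H_def using sets.compl_sets[of _ "past (T n)"] by simp
  qed
  have H': "H n \<in> events" for n using past_subset_events[OF H] .
  have "w \<le> 1"
    using uniform[of 1 "space P"] sets.top[of "past 1"] prob_space prob_le_1 order_trans by fastforce
  have "prob (H n) \<le> (1 - w) ^ n" for n
  proof (induction n)
    case 0
    show ?case by simp
  next
    case (Suc n)
    let ?U = "\<Union>l\<in>{T n+1..T n+D}. occurrence M B l"
    have U: "?U \<in> events"
      using B by (intro sets.finite_UN occurrence_events) auto
    have "H (Suc n) \<subseteq> H n - ?U" unfolding H_def T_def by fastforce
    then have "prob (H (Suc n)) \<le> prob (H n - ?U)" using H' U by (intro finite_measure_mono) auto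
    also have "\<dots> = prob (H n) - prob (H n \<inter> ?U)" using H' U by (intro finite_measure_Diff') auto
    also have "\<dots> \<le> (1 - w) * prob (H n)"
      using uniform[OF _ H, of n] k by (simp add: T_def algebra_simps)
    also have "\<dots> \<le> (1 - w) * (1 - w) ^ n" using Suc \<open>w \<le> 1\<close> by (intro mult_left_mono) auto
    finally show ?case by simp
  qed
  moreover have "prob (\<Inter>n. H n) \<le> prob (H n)" for n using H' by (intro finite_measure_mono) auto
  ultimately have bound: "prob (\<Inter>n. H n) \<le> (1 - w) ^ n" for n by (meson order_trans)
  have "(\<lambda>n. (1 - w) ^ n) \<longlonglongrightarrow> 0" using w \<open>w \<le> 1\<close> by (intro LIMSEQ_power_zero) auto
  then have "prob (\<Inter>n. H n) \<le> 0" by (rule LIMSEQ_le_const) (use bound in auto)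
  then have "(\<Inter>n. H n) \<in> null_sets P"
    using H' by (auto simp: null_sets_def emeasure_eq_measure intro!: sets.countable_INT antisym)
  then show ?thesis
  proof (rule AE_I')
    have "\<exists>l>k. \<omega> \<in> occurrence M B l" if "\<omega> \<notin> H n" "\<omega> \<in> space P" for n \<omega>
      using that unfolding H_def by auto
    then show "{\<omega> \<in> space P. \<not> (\<exists>l>k. \<omega> \<in> occurrence M B l)} \<subseteq> (\<Inter>n. H n)" by blast
  qed
qed

lemma pattern_infinitely_often:
  assumes irr: "irreducible_matrix p" and M: "1 \<le> M"
    and B: "\<And>l. 1 \<le> l \<Longrightarrow> l \<le> M \<Longrightarrow> B l \<in> sets borel"
    and g: "\<And>l. 1 < l \<Longrightarrow> l \<le> M \<Longrightarrow> 0 < p (g (l - 1)) (g l)"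
    and mass: "\<And>l. 1 \<le> l \<Longrightarrow> l \<le> M \<Longrightarrow> 0 < enn2real (emission_mass \<mu> f (g l) (B l))"
  shows "prob (infinitely_often P X M (Pi\<^sub>E {1..M} B)) = 1"
proof -
  have io: "infinitely_often P X M (Pi\<^sub>E {1..M} B) = (\<Inter>k\<in>{1..}. \<Union>l\<in>{k..}. occurrence M B l)"
    unfolding infinitely_often_def occurrence_def by (simp add: restrict_PiE_iff del: restrict_PiE atLeastAtMost_iff)
  have occ: "occurrence M B l \<in> events" if "1 \<le> l" for l
    using B that by (rule occurrence_events)
  have events: "(\<Inter>k\<in>{1..}. \<Union>l\<in>{k..}. occurrence M B l) \<in> events"
  proof (rule sets.countable_INT')
    show "(\<lambda>k. \<Union>l\<in>{k..}. occurrence M B l) ` {1..} \<subseteq> events"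
      by (auto intro!: sets.countable_UN' occ)
  qed auto
  have "AE \<omega> in P. \<forall>k\<in>{1..}. \<exists>l>k. \<omega> \<in> occurrence M B l"
    by (subst AE_ball_countable) (auto intro!: pattern_eventually_occurs[OF irr M, of B g] B mass intro: g)
  then have "AE \<omega> in P. \<omega> \<in> (\<Inter>k\<in>{1..}. \<Union>l\<in>{k..}. occurrence M B l)"
  proof eventually_elim
    case (elim \<omega>)
    show ?case
    proof (intro INT_I)
      fix k :: nat assume "k \<in> {1..}"
      then obtain l where "l > k" "\<omega> \<in> occurrence M B l" using elim by blast
      then show "\<omega> \<in> (\<Union>l\<in>{k..}. occurrence M B l)" by (intro UN_I[of l]) auto
    qed
  qed
  then show ?thesis unfolding io using events by (simp add: prob_eq_1)
qed

end

section \<open>Truncated observation sets\<close>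

lemma eventually_emeasure_pos:
  assumes "\<And>K. A K \<in> sets M" "incseq A" "0 < emeasure M (\<Union>K. A K)"
  shows "eventually (\<lambda>K. 0 < emeasure M (A K)) sequentially"
proof -
  have "0 < (SUP K. emeasure M (A K))"
    using assms by (subst SUP_emeasure_incseq) auto
  then obtain K0 where K0: "0 < emeasure M (A K0)" by (auto simp: less_SUP_iff)
  show ?thesis
  proof (rule eventually_sequentiallyI[of K0])
    fix K assume "K0 \<le> K"
    then have "emeasure M (A K0) \<le> emeasure M (A K)"
      using assms by (intro emeasure_mono) (auto simp: incseq_def)
    then show "0 < emeasure M (A K)" using K0 by order
  qed
qed

text \<open>On this set the densities are bounded above and, where positive, bounded away from \<open>0\<close>. The
  sets exhaust the whole space as \<open>K\<close> grows, because there are finitely many states.\<close>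

definition trunc :: "nat \<Rightarrow> ('y \<Rightarrow> 'x \<Rightarrow> real) \<Rightarrow> 'x set" where
  "trunc K f = {x. \<forall>j. f j x \<le> real (Suc K) \<and> (0 < f j x \<longrightarrow> inverse (real (Suc K)) \<le> f j x)}"

definition cluster_set :: "nat \<Rightarrow> ('y \<Rightarrow> 'x \<Rightarrow> real) \<Rightarrow> 'y set \<Rightarrow> 'x set" where
  "cluster_set K f C = {x \<in> trunc K f. \<forall>j. 0 < f j x \<longleftrightarrow> j \<in> C}"

text \<open>The strict inequality of the dominance hypothesis is sharpened to a fixed factor
  \<open>\<rho> = 1 - 1 / (K + 1)\<close>, the contraction rate of the barrier.\<close>

definition dominance_set :: "nat \<Rightarrow> ('y::finite \<Rightarrow> 'y \<Rightarrow> real) \<Rightarrow> ('y \<Rightarrow> 'x \<Rightarrow> real) \<Rightarrow> 'y \<Rightarrow> 'x set" where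
  "dominance_set K p f j = {x \<in> trunc K f. 0 < f j x \<and>
     (\<forall>i. i \<noteq> j \<longrightarrow> f i x * col_max p i \<le> (1 - inverse (real (Suc K))) * (f j x * col_max p j))}"

lemma inverse_Suc_antimono: "K \<le> L \<Longrightarrow> inverse (real (Suc L)) \<le> inverse (real (Suc K))"
  by (intro le_imp_inverse_le) auto

lemma trunc_mono:
  assumes "K \<le> L"
  shows "trunc K f \<subseteq> trunc L f"
proof
  fix x assume "x \<in> trunc K f"
  then have x: "f j x \<le> real (Suc K)" "0 < f j x \<Longrightarrow> inverse (real (Suc K)) \<le> f j x" for j
    by (auto simp: trunc_def)
  have "real (Suc K) \<le> real (Suc L)" using assms by simp
  then show "x \<in> trunc L f"
    using x inverse_Suc_antimono[OF assms] unfolding trunc_def mem_Collect_eq by (meson order_trans)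
qed

lemma eventually_trunc:
  fixes f :: "'y::finite \<Rightarrow> 'x \<Rightarrow> real"
  shows "eventually (\<lambda>K. x \<in> trunc K f) sequentially"
  unfolding trunc_def mem_Collect_eq
proof (intro eventually_all_finite eventually_conj)
  fix j
  show "eventually (\<lambda>K. f j x \<le> real (Suc K)) sequentially"
    by (rule eventually_sequentiallyI[of "nat \<lceil>f j x\<rceil>"]) linarith
  show "eventually (\<lambda>K. 0 < f j x \<longrightarrow> inverse (real (Suc K)) \<le> f j x) sequentially"
  proof (cases "0 < f j x")
    case True
    then show ?thesis
      using order_tendstoD(2)[OF LIMSEQ_inverse_real_of_nat, of "f j x"]
      by (auto elim!: eventually_mono)
  qed simp
qed

context hidden_markov
begin

lemma trunc_measurable [measurable]: "trunc K f \<in> sets borel"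
  unfolding trunc_def by measurable

lemma cluster_set_measurable: "cluster_set K f C \<in> sets borel"
  unfolding cluster_set_def by measurable

lemma dominance_set_measurable: "dominance_set K p f j \<in> sets borel"
  unfolding dominance_set_def by measurable

lemma eventually_cluster_set_pos:
  assumes "weak_cluster \<mu> f C"
  shows "eventually (\<lambda>K. 0 < emeasure \<mu> (cluster_set K f C)) sequentially"
proof (rule eventually_emeasure_pos)
  show "cluster_set K f C \<in> sets \<mu>" for K using cluster_set_measurable sets_mu by simp
  show "incseq (\<lambda>K. cluster_set K f C)"
    using trunc_mono[of _ _ f] unfolding incseq_def cluster_set_def by blast
  have "(\<Union>K. cluster_set K f C) = (\<Inter>i\<in>C. {x. 0 < f i x}) - (\<Union>i\<in>-C. {x. 0 < f i x})"
  proof (intro equalityI subsetI)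
    fix x assume x: "x \<in> (\<Inter>i\<in>C. {x. 0 < f i x}) - (\<Union>i\<in>-C. {x. 0 < f i x})"
    obtain K where "x \<in> trunc K f"
      using eventually_happens[OF eventually_trunc[of x f]] by auto
    then show "x \<in> (\<Union>K. cluster_set K f C)" using x by (auto simp: cluster_set_def)
  qed (auto simp: cluster_set_def)
  then show "0 < emeasure \<mu> (\<Union>K. cluster_set K f C)"
    using assms by (simp add: weak_cluster_def)
qed

lemma eventually_dominance_set_pos:
  assumes "0 < emeasure \<mu>
     {x. f j x * col_max p j > Max (insert 0 ((\<lambda>i. f i x * col_max p i) ` {i. i \<noteq> j}))}"
    (is "0 < emeasure \<mu> ?D")
  shows "eventually (\<lambda>K. 0 < emeasure \<mu> (dominance_set K p f j)) sequentially"
proof (rule eventually_emeasure_pos)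
  have col: "0 \<le> col_max p i" for i using le_col_max[of p i i] p_nonneg[of i i] by linarith
  show meas: "dominance_set K p f j \<in> sets \<mu>" for K using dominance_set_measurable sets_mu by simp
  show "incseq (\<lambda>K. dominance_set K p f j)"
    unfolding incseq_def
  proof (intro allI impI subsetI)
    fix K L :: nat and x assume KL: "K \<le> L" and x: "x \<in> dominance_set K p f j"
    have "(1 - inverse (real (Suc K))) * (f j x * col_max p j)
        \<le> (1 - inverse (real (Suc L))) * (f j x * col_max p j)"
      using inverse_Suc_antimono[OF KL] f_nonneg col by (intro mult_right_mono) auto
    then show "x \<in> dominance_set L p f j"
      using x trunc_mono[OF KL, of f] unfolding dominance_set_def by (auto intro: order_trans)
  qed
  have "?D \<subseteq> (\<Union>K. dominance_set K p f j)"
  proof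
    fix x assume x: "x \<in> ?D"
    let ?d = "f j x * col_max p j"
    have "finite (insert 0 ((\<lambda>i. f i x * col_max p i) ` {i. i \<noteq> j}))" by simp
    from Max_less_iff[OF this, of ?d] x
    have d: "0 < ?d" "\<And>i. i \<noteq> j \<Longrightarrow> f i x * col_max p i < ?d" by auto
    have "((\<lambda>K. (1 - inverse (real (Suc K))) * ?d) \<longlongrightarrow> (1 - 0) * ?d) sequentially"
      by (intro tendsto_intros LIMSEQ_inverse_real_of_nat)
    then have lim: "((\<lambda>K. (1 - inverse (real (Suc K))) * ?d) \<longlongrightarrow> ?d) sequentially" by simp
    have "eventually (\<lambda>K. \<forall>i. i \<noteq> j \<longrightarrow>
        f i x * col_max p i \<le> (1 - inverse (real (Suc K))) * ?d) sequentially"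
    proof (intro eventually_all_finite)
      fix i
      show "eventually (\<lambda>K. i \<noteq> j \<longrightarrow>
          f i x * col_max p i \<le> (1 - inverse (real (Suc K))) * ?d) sequentially"
      proof (cases "i = j")
        case False
        show ?thesis
          using order_tendstoD(1)[OF lim d(2)[OF False]] by (auto elim!: eventually_mono)
      qed simp
    qed
    from eventually_happens[OF eventually_conj[OF this eventually_trunc[of x f]]]
    obtain K where "x \<in> trunc K f"
      "\<forall>i. i \<noteq> j \<longrightarrow> f i x * col_max p i \<le> (1 - inverse (real (Suc K))) * ?d"
      by auto
    moreover have "0 < f j x" using d(1) f_nonneg[of j x] col[of j] by (simp add: zero_less_mult_iff)
    ultimately show "x \<in> (\<Union>K. dominance_set K p f j)" by (auto simp: dominance_set_def)
  qed
  then have "emeasure \<mu> ?D \<le> emeasure \<mu> (\<Union>K. dominance_set K p f j)"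
    using meas by (intro emeasure_mono) auto
  then show "0 < emeasure \<mu> (\<Union>K. dominance_set K p f j)" using assms by order
qed

section \<open>Barriers occur infinitely often\<close>

lemma positive_transition_bound:
  obtains \<pi> where "0 < \<pi>" "\<pi> \<le> 1" "\<And>i j. 0 < p i j \<Longrightarrow> \<pi> \<le> p i j"
proof -
  let ?A = "insert 1 ((\<lambda>(i, j). p i j) ` {(i, j). 0 < p i j})"
  have "finite ?A" "?A \<noteq> {}" by auto
  then have "0 < Min ?A" by (subst Min_gr_iff) auto
  moreover have "Min ?A \<le> p i j" if "0 < p i j" for i j
    using \<open>finite ?A\<close> that by (intro Min_le) auto
  moreover have "Min ?A \<le> 1" using \<open>finite ?A\<close> by (intro Min_le) auto
  ultimately show ?thesis using that by blast
qed

text \<open>The word consists of \<open>2 * R + 1\<close> cluster observations, a connecting path from \<open>c\<close>, a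
  dominant run back to \<open>c\<close>, and \<open>R\<close> cluster observations. Paths are caught by the cluster at position
  \<open>w = R + 1\<close>, which leaves \<open>R\<close> steps to reach \<open>c\<close>. The \<open>R\<close> positions before \<open>w\<close> ensure
  \<open>2 \<le> w\<close>, and their number is chosen so that the emitting state path can pass from \<open>c\<close> to \<open>c\<close>
  within the cluster there as well.\<close>

theorem barriers_infinitely_often:
  assumes dominance: "\<And>j. 0 < emeasure \<mu>
          {x. f j x * col_max p j > Max (insert 0 ((\<lambda>i. f i x * col_max p i) ` {i. i \<noteq> j}))}"
    and C: "weak_cluster \<mu> f C" "C \<noteq> {}" "primitive_on C p"
    and irr: "irreducible_matrix p"
  shows "\<exists>(i::'y) M r S. 1 \<le> M \<and> S \<subseteq> {1..M} \<rightarrow>\<^sub>E (UNIV :: 'x set) \<and>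
           (\<forall>b\<in>S. strong_barrier p\<^sub>1 (hmm_q p f) i r M b) \<and>
           measure P (infinitely_often P X M S) = 1"
proof -
  obtain R where R: "1 \<le> R" "\<And>i j. i \<in> C \<Longrightarrow> j \<in> C \<Longrightarrow> 0 < submatrix_power C p R i j"
    using C(3) unfolding primitive_on_def by blast
  obtain c where c: "c \<in> C" using C(2) by blast
  have "eventually (\<lambda>K. \<forall>j. 0 < emeasure \<mu> (dominance_set K p f j)) sequentially"
    by (intro eventually_all_finite eventually_dominance_set_pos dominance)
  from eventually_happens[OF eventually_conj[OF this eventually_cluster_set_pos[OF C(1)]]]
  obtain K where K: "\<And>j. 0 < emeasure \<mu> (dominance_set K p f j)" "0 < emeasure \<mu> (cluster_set K f C)"
    by auto
  define U where "U = real (Suc K)"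
  define \<epsilon> where "\<epsilon> = inverse (real (Suc K))"
  have U: "1 \<le> U" and \<epsilon>: "0 < \<epsilon>" "\<epsilon> \<le> 1" by (auto simp: U_def \<epsilon>_def field_simps)
  obtain \<pi> where \<pi>: "0 < \<pi>" "\<pi> \<le> 1" "\<And>i j. 0 < p i j \<Longrightarrow> \<pi> \<le> p i j"
    using positive_transition_bound by blast
  define Q where "Q = U / (\<pi> * \<epsilon>)"
  have "\<pi> * \<epsilon> \<le> 1" using \<pi> \<epsilon> by (simp add: mult_le_one)
  then have Q: "1 \<le> Q" using \<pi> \<epsilon> U by (simp add: Q_def)
  obtain D where D: "\<And>c L. \<exists>n g. n \<le> (D::nat) \<and> g 0 = c \<and> g (n + L) = c \<and>
      (\<forall>k. 0 < k \<longrightarrow> k \<le> n + L \<longrightarrow> 0 < p (g (k - 1)) (g k)) \<and>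
      (\<forall>k. n < k \<longrightarrow> k \<le> n + L \<longrightarrow> p (g (k - 1)) (g k) = col_max p (g k))"
    using dominant_excursion[OF p_nonneg irr] by blast
  have "0 < Q ^ (R + D)" using Q by simp
  then obtain N where "(1 - \<epsilon>) ^ N < 1 / Q ^ (R + D)"
    using real_arch_pow_inv[of "1 / Q ^ (R + D)" "1 - \<epsilon>"] \<epsilon> by auto
  then have N: "(1 - \<epsilon>) ^ N * Q ^ (R + D) \<le> 1" using \<open>0 < Q ^ (R + D)\<close> by (simp add: field_simps)
  \<comment> \<open>Now that \<open>N\<close> is fixed, the run is chosen; the bound \<open>n \<le> D\<close> was needed to choose \<open>N\<close>.\<close>
  obtain n h where n: "n \<le> D" and h: "h 0 = c" "h (n + (N + 1 + N)) = c"
    and h_pos: "\<And>k. 0 < k \<Longrightarrow> k \<le> n + (N + 1 + N) \<Longrightarrow> 0 < p (h (k - 1)) (h k)"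
    and h_run: "\<And>k. n < k \<Longrightarrow> k \<le> n + (N + 1 + N) \<Longrightarrow> p (h (k - 1)) (h k) = col_max p (h k)"
    using D[of c "N + 1 + N"] by blast
  \<comment> \<open>The cluster observations occupy the positions up to \<open>pre\<close> and after \<open>u\<close>; the run lies between \<open>s\<close> and \<open>u\<close>.\<close>
  define pre where "pre = 2 * R + 1"
  define w where "w = R + 1"
  define s where "s = pre + n"
  define u where "u = s + N + 1 + N"
  define M where "M = u + R"
  define g where "g = (\<lambda>k. h (k - pre))"
  define E where "E = (\<lambda>l. if pre < l \<and> l \<le> u then {g l} else C)"
  define A where "A = (\<lambda>l. if pre < l \<and> l \<le> u then dominance_set K p f (g l) else cluster_set K f C)"
  note time = pre_def w_def s_def u_def M_def
  have A_trunc: "A l \<subseteq> trunc K f" for l by (auto simp: A_def dominance_set_def cluster_set_def)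
  have A_pos: "0 < f j x" if "x \<in> A l" "j \<in> E l" for x l j
    using that by (auto simp: A_def E_def dominance_set_def cluster_set_def split: if_splits)
  have A_cluster: "j \<in> C" if "x \<in> A l" "0 < f j x" "l \<le> pre \<or> u < l" for x l j
    using that by (auto simp: A_def cluster_set_def)
  have A_sets: "A l \<in> sets borel" for l
    by (simp add: A_def cluster_set_measurable dominance_set_measurable)
  have g: "g pre = c" "g u = c"
    using h by (simp_all add: g_def s_def u_def add.assoc)
  have g_pos: "0 < p (g (k - 1)) (g k)" if "pre < k" "k \<le> u" for k
    using h_pos[of "k - pre"] that by (simp add: g_def s_def u_def diff_commute)
  have in_cluster: "linked p E t (t + R) i j"
    if "i \<in> C" "j \<in> C" "t + R \<le> pre \<or> u \<le> t" for i j t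
    using linked_of_submatrix_power[of p C R i j t E] p_nonneg R(2) that by (auto simp: E_def)
  have along: "linked p E pre t c (g t)" if "pre \<le> t" "t \<le> u" for t
    by (rule linkedI[of g]) (use g g_pos that in \<open>auto simp: E_def\<close>)
  have barrier: "strong_barrier p\<^sub>1 (hmm_q p f) (g (s + N + 1)) (M - (s + N + 1)) M b"
    if b: "b \<in> Pi\<^sub>E {1..M} A" for b
  proof (rule strong_barrier_of_word[where w = w and U = U and \<epsilon> = \<epsilon> and \<pi> = \<pi> and \<rho> = "1 - \<epsilon>" and E = E
        and B = "Q ^ (R + D)"])
    have bA: "b l \<in> A l" if "1 \<le> l" "l \<le> M" for l using b that by auto
    show "b \<in> {1..M} \<rightarrow>\<^sub>E UNIV" using b by auto
    show "2 \<le> w" "w \<le> s" "s + N + 1 + N < M" using R by (auto simp: time)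
    show "f j (b l) \<le> U" if "1 \<le> l" "l \<le> M" for l j
      using bA[OF that] A_trunc by (auto simp: trunc_def U_def)
    show "\<epsilon> \<le> f j (b l)" if "1 \<le> l" "l \<le> M" "j \<in> E l" for l j
      using bA[OF that(1,2)] A_trunc A_pos[OF bA[OF that(1,2)] that(3)] by (auto simp: trunc_def \<epsilon>_def)
    show "linked p E w s j (g s)" if "0 < f j (b w)" for j
    proof (rule linked_trans)
      have "w + R = pre" by (simp add: time)
      moreover have "j \<in> C" using A_cluster[of "b w" w j] bA[of w] that by (simp add: time)
      ultimately show "linked p E w pre j c" using in_cluster[of j c w] c by simp
      show "linked p E pre s c (g s)" by (rule along) (auto simp: time)
    qed (auto simp: time)
    show "linked p E (s + N + 1 + N) M (g (s + N + 1 + N)) j" if "0 < f j (b M)" for j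
    proof -
      have "j \<in> C" using A_cluster[of "b M" M j] bA[of M] that R by (simp add: M_def)
      then have "linked p E u M (g u) j" using in_cluster[of c j u] c g by (simp add: M_def)
      then show ?thesis by (simp only: u_def)
    qed
    show "p (g (k - 1)) (g k) = col_max p (g k)" if "s < k" "k \<le> s + N + 1 + N" for k
      using h_run[of "k - pre"] that by (simp add: g_def s_def diff_commute)
    show "f j (b k) * col_max p j \<le> (1 - \<epsilon>) * (f (g k) (b k) * col_max p (g k))"
      if "s < k" "k \<le> s + N + 1 + N" "j \<noteq> g k" for k j
      using bA[of k] that by (auto simp: A_def dominance_set_def \<epsilon>_def time)
    have "Q ^ (s - w) \<le> Q ^ (R + D)" "Q ^ (M - (s + N + 1 + N)) \<le> Q ^ (R + D)"
      using Q n by (intro power_increasing; simp add: time)+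
    then show "(U / (\<pi> * \<epsilon>)) ^ (s - w) \<le> Q ^ (R + D)"
      "(U / (\<pi> * \<epsilon>)) ^ (M - (s + N + 1 + N)) \<le> Q ^ (R + D)"
      by (simp_all add: Q_def)
  qed (use p1_nonneg p_nonneg p_le_1 f_nonneg \<pi> \<epsilon> U N in auto)
  \<comment> \<open>The state path that emits the word: every piece starts and ends in \<open>c\<close>.\<close>
  have "linked p E 1 M c c"
  proof -
    have "linked p E 1 w c c" using in_cluster[of c c 1] c by (simp add: w_def pre_def)
    moreover have "linked p E w pre c c"
      using in_cluster[of c c w] c by (simp add: w_def pre_def mult_2)
    moreover have "linked p E pre u c c" using along[of u] g by (simp add: s_def u_def)
    moreover have "linked p E u M c c" using in_cluster[of c c u] c by (simp add: M_def)
    moreover have "1 \<le> w" "w \<le> pre" "pre \<le> u" "u \<le> M" by (simp_all add: time)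
    ultimately show ?thesis by (meson linked_trans order_trans)
  qed
  then obtain y where y: "y 1 = c" "\<And>k. 1 < k \<Longrightarrow> k \<le> M \<Longrightarrow> 0 < p (y (k - 1)) (y k) \<and> y k \<in> E k"
    unfolding linked_def by blast
  have y_E: "y l \<in> E l" if "1 \<le> l" "l \<le> M" for l
    using y(1) y(2)[of l] that c by (cases "l = 1") (auto simp: E_def pre_def)
  have "prob (infinitely_often P X M (Pi\<^sub>E {1..M} A)) = 1"
  proof (rule pattern_infinitely_often[OF irr, where g = y])
    show "1 \<le> M" by (simp add: time)
    show "0 < p (y (l - 1)) (y l)" if "1 < l" "l \<le> M" for l using y(2)[OF that] by simp
    show "0 < enn2real (emission_mass \<mu> f (y l) (A l))" if "1 \<le> l" "l \<le> M" for l
    proof (rule emission_mass_pos[OF A_sets])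
      show "0 < emeasure \<mu> (A l)" using K by (simp add: A_def)
      show "0 < f (y l) x" if "x \<in> A l" for x by (rule A_pos[OF that y_E]) fact+
    qed
  qed (rule A_sets)
  moreover have "1 \<le> M" by (simp add: time)
  moreover have "Pi\<^sub>E {1..M} A \<subseteq> {1..M} \<rightarrow>\<^sub>E UNIV" by (intro PiE_mono) auto
  ultimately show ?thesis using barrier by blast
qed

end

theorem corollary4p1:
  fixes P :: "'w measure"
    and X :: "nat \<Rightarrow> 'w \<Rightarrow> 'x::{metric_space, second_countable_topology}"
    and Y :: "nat \<Rightarrow> 'w \<Rightarrow> 'y::finite"
    and \<mu> \<nu> :: "'x measure"
    and p :: "'y \<Rightarrow> 'y \<Rightarrow> real"
    and f :: "'y \<Rightarrow> 'x \<Rightarrow> real"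
    and p\<^sub>1 :: "'x \<times> 'y \<Rightarrow> real"
  assumes hmm: "hidden_markov_model P X Y \<mu> p f \<nu> p\<^sub>1"
    (* the terms are nonnegative, so inserting 0 matters only for a one-element state space,
       where it fixes the maximum over the empty index set to be 0 *)
    and dominance: "\<And>j. 0 < emeasure \<mu>
          {x. f j x * col_max p j > Max (insert 0 ((\<lambda>i. f i x * col_max p i) ` {i. i \<noteq> j}))}"
    and cluster: "\<exists>C. weak_cluster \<mu> f C \<and> C \<noteq> {} \<and> primitive_on C p"
    and irreducible: "irreducible_matrix p"
  shows "\<exists>(i::'y) M r S. 1 \<le> M \<and> S \<subseteq> {1..M} \<rightarrow>\<^sub>E (UNIV :: 'x set) \<and>
           (\<forall>b\<in>S. strong_barrier p\<^sub>1 (hmm_q p f) i r M b) \<and>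
           measure P (infinitely_often P X M S) = 1"
proof -
  interpret hidden_markov P X Y \<mu> \<nu> p f p\<^sub>1 by unfold_locales (rule hmm)
  obtain C where "weak_cluster \<mu> f C" "C \<noteq> {}" "primitive_on C p" using cluster by blast
  then show ?thesis by (rule barriers_infinitely_often[OF dominance]) (rule irreducible)
qed

end
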